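(* Let $\mathfrak g,\mathfrak n$ be topological Lie algebras over $\mathbb K$, $S:\mathfrak g\to\mathrm{der}\,\mathfrak n$ a continuous outer action, and let $q:\hat{\mathfrak g}\to\mathfrak g$ be a topologically split extension of $\mathfrak g$ by $\mathfrak n$ corresponding to the continuous $\mathfrak g$-kernel $[S]$, with $\mathrm{ad}_{\mathfrak n}$ the corresponding representation of $\hat{\mathfrak g}$ on $\mathfrak n$. Assume that $\mathfrak z(\mathfrak n)$ is topologically split in $\mathfrak n$. Then the map $$\gamma=(\mathrm{ad}_{\mathfrak n}-S\circ q,\,q):\hat{\mathfrak g}\to\mathrm{der}(\mathfrak n)\times\mathfrak g,\quad x\mapsto(\mathrm{ad}_{\mathfrak n}(x)-S(q(x)),q(x))$$ defines a topologically split extension $\mathfrak z(\mathfrak n)\hookrightarrow\hat{\mathfrak g}\xrightarrow{\ \gamma\ }\mathfrak g^S$. This assignment has the following properties: (1) If $q_j:\hat{\mathfrak g}_j\to\mathfrak g$, $j=1,2$, are equivalent extensions of $\mathfrak g$ by $\mathfrak n$ (corresponding to $[S]$), then the associated $\gamma_j:\hat{\mathfrak g}_j\to\mathfrak g^S$ are equivalent extensions of $\mathfrak g^S$ by the $\mathfrak g^S$-module $\mathfrak z(\mathfrak n)$. One thus obtains a map $\tau:\mathrm{Ext}(\mathfrak g,\mathfrak n)_{[S]}\to\mathrm{Ext}(\mathfrak g^S,\mathfrak z(\mathfrak n))$. (2) An extension $\gamma:\hat{\mathfrak g}\to\mathfrak g^S$ of $\mathfrak g^S$ by $\mathfrak z(\mathfrak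 n)$ comes from an extension of $\mathfrak g$ by $\mathfrak n$ corresponding to $[S]$ if and only if there exists a $\mathfrak g^S$-equivariant equivalence $\alpha:\mathfrak n\to\gamma^{-1}(\mathfrak n_{\mathrm{ad}})$ of central extensions of $\mathfrak n_{\mathrm{ad}}$ by $\mathfrak z(\mathfrak n)$.
   Context: $\mathbb K$ is a topological field of characteristic $0$ (discrete topology allowed); topological vector spaces are Hausdorff. $C^p(\mathfrak g,V)$: continuous alternating $p$-linear maps; $\mathrm{der}\,\mathfrak n$: continuous derivations; $\mathfrak z(\mathfrak n)$: center. A continuous outer action is a linear map $S:\mathfrak g\to\mathrm{der}\,\mathfrak n$ with $(x,n)\mapsto S(x).n$ continuous and $R_S(x,y):=[S(x),S(y)]-S([x,y])=\mathrm{ad}(\omega(x,y))$ for some $\omega\in C^2(\mathfrak g,\mathfrak n)$. $S\sim S'$ if $S=S'+\mathrm{ad}\circ\gamma'$ with $\gamma':\mathfrak g\to\mathfrak n$ continuous linear; $[S]$ is called a continuous $\mathfrak g$-kernel. A subspace $W\subseteq V$ is topologically split if it is closed and $V\to V/W$ has a continuous linear section $\sigma$ with $W\times V/W\to V$, $(w,x)\mapsto w+\sigma(x)$ a topological isomorphism. A (topologically split) extension of $\mathfrak g$ by $\mathfrak n$ is a topological Lie algebra $\hat{\mathfrak g}$ containing $\mathfrak n$ as a topologically split ideal with a quotient morphism $q:\hat{\mathfrak g}\to\mathfrak g$ with kernel $\mathfrak n$; equivalences are isomorphisms of topological Lie algebras inducing the identity on $\mathfrak n$ and $\mathfrak g$;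 $\mathrm{Ext}(\mathfrak g,\mathfrak n)$ is the set of classes. It corresponds to $[S]$ if $[x\mapsto\mathrm{ad}(\sigma(x))|_{\mathfrak n}]=[S]$ for a continuous linear section $\sigma$ of $q$; $\mathrm{Ext}(\mathfrak g,\mathfrak n)_{[S]}$ is the set of such classes. $\mathrm{ad}_{\mathfrak n}(x)=\mathrm{ad}(x)|_{\mathfrak n}$ for $x\in\hat{\mathfrak g}$. $\mathfrak n_{\mathrm{ad}}:=\mathfrak n/\mathfrak z(\mathfrak n)\cong\mathrm{ad}\,\mathfrak n\subseteq\mathrm{der}\,\mathfrak n$ with the quotient topology. $\mathfrak g^S:=\mathfrak n_{\mathrm{ad}}\times\mathfrak g$ with the Lie bracket $[(\mathrm{ad}\,n,x),(\mathrm{ad}\,n',x')]=(\mathrm{ad}([n,n']+S(x).n'-S(x').n+\omega(x,x')),[x,x'])$ (independent of $\omega$); its underlying set is $\mathrm{ad}\,\mathfrak n\times\mathfrak g\subseteq\mathrm{der}(\mathfrak n)\times\mathfrak g$. $\mathfrak g^S$ acts continuously on $\mathfrak n$ by $(\mathrm{ad}\,n,x).n'=[n,n']+S(x).n'$, and $\mathfrak z(\mathfrak n)$ is a submodule. $\mathfrak n$ is a central extension of $\mathfrak n_{\mathrm{ad}}$ by $\mathfrak z(\mathfrak n)$ via $\mathrm{ad}$. In (2), extensions of $\mathfrak g^S$ by $\mathfrak z(\mathfrak n)$ are topologically split abelian extensions inducing the given $\mathfrak g^S$-module structure on $\mathfrak z(\mathfrak n)$; $\mathfrak n_{\mathrm{ad}}$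 is identified with $\mathfrak n_{\mathrm{ad}}\times\{0\}\subseteq\mathfrak g^S$, $\mathfrak g^S\cong\hat{\mathfrak g}/\mathfrak z(\mathfrak n)$ acts on $\gamma^{-1}(\mathfrak n_{\mathrm{ad}})$ through the adjoint action of $\hat{\mathfrak g}$, and "comes from" means that there is a topologically split extension $q:\hat{\mathfrak g}\to\mathfrak g$ of $\mathfrak g$ by $\mathfrak n$ corresponding to $[S]$ (with the same Lie algebra $\hat{\mathfrak g}$, the inclusion of $\mathfrak n$ into $\hat{\mathfrak g}$ restricting to the given inclusion of $\mathfrak z(\mathfrak n)$) such that $\gamma(x)=(\mathrm{ad}_{\mathfrak n}(x)-S(q(x)),q(x))$ for all $x\in\hat{\mathfrak g}$. *)

theory Defs
  imports "HOL-Analysis.T1_Spaces" "HOL-Algebra.Module" "HOL-Algebra.AbelCoset"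
begin

section \<open>Topological fields and topological vector spaces\<close>

record 'k top_ring = "'k ring" +
  ring_top :: "'k topology"

text \<open>No separation axiom is imposed on the ground field; the discrete topology is allowed.\<close>

locale topological_field = field K for K :: "'k top_ring" (structure) +
  assumes char_zero: "\<And>n::nat. n > 0 \<Longrightarrow> [n] \<cdot> \<one> \<noteq> \<zero>"
    and topspace_ring: "topspace (ring_top K) = carrier K"
    and continuous_add:
      "continuous_map (prod_topology (ring_top K) (ring_top K)) (ring_top K) (\<lambda>(a, b). a \<oplus> b)"
    and continuous_uminus: "continuous_map (ring_top K) (ring_top K) (\<lambda>a. \<ominus> a)"
    and continuous_mult:
      "continuous_map (prod_topology (ring_top K) (ring_top K)) (ring_top K) (\<lambda>(a, b). a \<otimes> b)"
    and continuous_inverse: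
      "continuous_map (subtopology (ring_top K) (carrier K - {\<zero>})) (ring_top K) (\<lambda>a. inv a)"

text \<open>
  The record below is used for topological vector spaces and for topological Lie algebras.
  In the latter case the product \<open>mult\<close> inherited from the library record \<open>module\<close> is the Lie
  bracket; no associativity or unit law is ever assumed for it, and the field \<open>one\<close> carries
  no meaning.
\<close>

record ('k, 'v) top_module = "('k, 'v) module" +
  vtop :: "'v topology"

abbreviation lie_bracket :: "[('v, 'm) monoid_scheme, 'v, 'v] \<Rightarrow> 'v"
  (\<open>(1\<^bold>[_,/ _\<^bold>]\<index>)\<close>)
  where "\<^bold>[x, y\<^bold>]\<^bsub>L\<^esub> \<equiv> x \<otimes>\<^bsub>L\<^esub> y"

locale topological_vector_space = topological_field K + Module.module K V
  for K :: "'k top_ring" and V :: "('k, 'v) top_module" +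
  assumes topspace_vtop: "topspace (vtop V) = carrier V"
    and Hausdorff_vtop: "Hausdorff_space (vtop V)"
    and continuous_vadd:
      "continuous_map (prod_topology (vtop V) (vtop V)) (vtop V) (\<lambda>(x, y). x \<oplus>\<^bsub>V\<^esub> y)"
    and continuous_smult:
      "continuous_map (prod_topology (ring_top K) (vtop V)) (vtop V) (\<lambda>(a, x). a \<odot>\<^bsub>V\<^esub> x)"

definition linear_map ::
  "'k top_ring \<Rightarrow> ('k, 'v, 'x) module_scheme \<Rightarrow> ('k, 'w, 'y) module_scheme \<Rightarrow> ('v \<Rightarrow> 'w) \<Rightarrow> bool"
  where "linear_map K V W f \<longleftrightarrow>
    f \<in> carrier V \<rightarrow> carrier W \<and>
    (\<forall>x\<in>carrier V. \<forall>y\<in>carrier V. f (x \<oplus>\<^bsub>V\<^esub> y) = f x \<oplus>\<^bsub>W\<^esub> f y) \<and>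
    (\<forall>a\<in>carrier K. \<forall>x\<in>carrier V. f (a \<odot>\<^bsub>V\<^esub> x) = a \<odot>\<^bsub>W\<^esub> f x)"

definition continuous_linear_map ::
  "'k top_ring \<Rightarrow> ('k, 'v) top_module \<Rightarrow> ('k, 'w) top_module \<Rightarrow> ('v \<Rightarrow> 'w) \<Rightarrow> bool"
  where "continuous_linear_map K V W f \<longleftrightarrow>
    linear_map K V W f \<and> continuous_map (vtop V) (vtop W) f"


section \<open>Quotients and topologically split subspaces\<close>

definition quotient_topology :: "'a topology \<Rightarrow> ('a \<Rightarrow> 'b) \<Rightarrow> 'b topology"
  where "quotient_topology X f =
    topology (\<lambda>U. U \<subseteq> f ` topspace X \<and> openin X {x \<in> topspace X. f x \<in> U})"

lemma openin_quotient_topology: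
  "openin (quotient_topology X f) U \<longleftrightarrow>
     U \<subseteq> f ` topspace X \<and> openin X {x \<in> topspace X. f x \<in> U}"
proof -
  let ?P = "\<lambda>U. U \<subseteq> f ` topspace X \<and> openin X {x \<in> topspace X. f x \<in> U}"
  have "istopology ?P"
    unfolding istopology_def
  proof (intro conjI allI impI)
    fix A B assume A: "?P A" and B: "?P B"
    have "{x \<in> topspace X. f x \<in> A \<inter> B} =
        {x \<in> topspace X. f x \<in> A} \<inter> {x \<in> topspace X. f x \<in> B}" by auto
    then show "openin X {x \<in> topspace X. f x \<in> A \<inter> B}" using A B by auto
    show "A \<inter> B \<subseteq> f ` topspace X" using A by auto
  next
    fix \<U> assume U: "\<forall>A\<in>\<U>. ?P A"
    have "{x \<in> topspace X. f x \<in> \<Union>\<U>} = (\<Union>A\<in>\<U>. {x \<in> topspace X. f x \<in> A})" by auto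
    then show "openin X {x \<in> topspace X. f x \<in> \<Union>\<U>}" using U by auto
    show "\<Union>\<U> \<subseteq> f ` topspace X" using U by auto
  qed
  then show ?thesis
    by (simp add: quotient_topology_def topology_inverse')
qed

lemma topspace_quotient_topology: "topspace (quotient_topology X f) = f ` topspace X"
proof (rule antisym)
  show "topspace (quotient_topology X f) \<subseteq> f ` topspace X"
    using openin_quotient_topology[of X f "topspace (quotient_topology X f)"] by simp
  have "{x \<in> topspace X. f x \<in> f ` topspace X} = topspace X" by auto
  then have "openin (quotient_topology X f) (f ` topspace X)"
    by (simp add: openin_quotient_topology)
  then show "f ` topspace X \<subseteq> topspace (quotient_topology X f)"
    by (rule openin_subset)
qed

lemma quotient_map_quotient_topology: "quotient_map X (quotient_topology X f) f"
  unfolding quotient_map_def by (simp add: openin_quotient_topology topspace_quotient_topology)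

text \<open>
  The quotient space \<open>V / W\<close>, realised on cosets. In the scalar multiplication the summand
  \<open>W\<close> is needed for the scalar \<open>0\<close> only.
\<close>

definition quotient_space :: "('k, 'v) top_module \<Rightarrow> 'v set \<Rightarrow> ('k, 'v set) top_module"
  where "quotient_space V W =
    \<lparr> carrier = a_rcosets\<^bsub>V\<^esub> W, mult = undefined, one = undefined,
      zero = W, add = (\<lambda>A B. A <+>\<^bsub>V\<^esub> B),
      smult = (\<lambda>a A. W <+>\<^bsub>V\<^esub> ((\<lambda>x. a \<odot>\<^bsub>V\<^esub> x) ` A)),
      vtop = quotient_topology (vtop V) (\<lambda>x. W +>\<^bsub>V\<^esub> x) \<rparr>"

definition topologically_split :: "'k top_ring \<Rightarrow> ('k, 'v) top_module \<Rightarrow> 'v set \<Rightarrow> bool"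
  where "topologically_split K V W \<longleftrightarrow>
    submodule W K V \<and> closedin (vtop V) W \<and>
    (\<exists>\<sigma>. continuous_linear_map K (quotient_space V W) V \<sigma> \<and>
         (\<forall>A\<in>carrier (quotient_space V W). W +>\<^bsub>V\<^esub> \<sigma> A = A) \<and>
         homeomorphic_map
           (prod_topology (subtopology (vtop V) W) (vtop (quotient_space V W))) (vtop V)
           (\<lambda>(w, A). w \<oplus>\<^bsub>V\<^esub> \<sigma> A))"


section \<open>Topological Lie algebras\<close>

locale topological_lie_algebra = topological_vector_space K L
  for K :: "'k top_ring" and L :: "('k, 'v) top_module" +
  assumes bracket_closed:
      "\<lbrakk>x \<in> carrier L; y \<in> carrier L\<rbrakk> \<Longrightarrow> \<^bold>[x, y\<^bold>]\<^bsub>L\<^esub> \<in> carrier L"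
    and bracket_add_left:
      "\<lbrakk>x \<in> carrier L; y \<in> carrier L; z \<in> carrier L\<rbrakk> \<Longrightarrow>
        \<^bold>[x \<oplus>\<^bsub>L\<^esub> y, z\<^bold>]\<^bsub>L\<^esub> = \<^bold>[x, z\<^bold>]\<^bsub>L\<^esub> \<oplus>\<^bsub>L\<^esub> \<^bold>[y, z\<^bold>]\<^bsub>L\<^esub>"
    and bracket_add_right:
      "\<lbrakk>x \<in> carrier L; y \<in> carrier L; z \<in> carrier L\<rbrakk> \<Longrightarrow>
        \<^bold>[x, y \<oplus>\<^bsub>L\<^esub> z\<^bold>]\<^bsub>L\<^esub> = \<^bold>[x, y\<^bold>]\<^bsub>L\<^esub> \<oplus>\<^bsub>L\<^esub> \<^bold>[x, z\<^bold>]\<^bsub>L\<^esub>"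
    and bracket_smult_left:
      "\<lbrakk>a \<in> carrier K; x \<in> carrier L; y \<in> carrier L\<rbrakk> \<Longrightarrow>
        \<^bold>[a \<odot>\<^bsub>L\<^esub> x, y\<^bold>]\<^bsub>L\<^esub> = a \<odot>\<^bsub>L\<^esub> \<^bold>[x, y\<^bold>]\<^bsub>L\<^esub>"
    and bracket_smult_right:
      "\<lbrakk>a \<in> carrier K; x \<in> carrier L; y \<in> carrier L\<rbrakk> \<Longrightarrow>
        \<^bold>[x, a \<odot>\<^bsub>L\<^esub> y\<^bold>]\<^bsub>L\<^esub> = a \<odot>\<^bsub>L\<^esub> \<^bold>[x, y\<^bold>]\<^bsub>L\<^esub>"
    and bracket_self: "x \<in> carrier L \<Longrightarrow> \<^bold>[x, x\<^bold>]\<^bsub>L\<^esub> = \<zero>\<^bsub>L\<^esub>"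
    and jacobi:
      "\<lbrakk>x \<in> carrier L; y \<in> carrier L; z \<in> carrier L\<rbrakk> \<Longrightarrow>
        \<^bold>[x, \<^bold>[y, z\<^bold>]\<^bsub>L\<^esub>\<^bold>]\<^bsub>L\<^esub> \<oplus>\<^bsub>L\<^esub> \<^bold>[y, \<^bold>[z, x\<^bold>]\<^bsub>L\<^esub>\<^bold>]\<^bsub>L\<^esub> \<oplus>\<^bsub>L\<^esub> \<^bold>[z, \<^bold>[x, y\<^bold>]\<^bsub>L\<^esub>\<^bold>]\<^bsub>L\<^esub> = \<zero>\<^bsub>L\<^esub>"
    and continuous_bracket:
      "continuous_map (prod_topology (vtop L) (vtop L)) (vtop L) (\<lambda>(x, y). \<^bold>[x, y\<^bold>]\<^bsub>L\<^esub>)"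

definition lie_hom ::
  "'k top_ring \<Rightarrow> ('k, 'v) top_module \<Rightarrow> ('k, 'w) top_module \<Rightarrow> ('v \<Rightarrow> 'w) \<Rightarrow> bool"
  where "lie_hom K L M f \<longleftrightarrow>
    linear_map K L M f \<and>
    (\<forall>x\<in>carrier L. \<forall>y\<in>carrier L. f \<^bold>[x, y\<^bold>]\<^bsub>L\<^esub> = \<^bold>[f x, f y\<^bold>]\<^bsub>M\<^esub>)"

definition top_lie_iso ::
  "'k top_ring \<Rightarrow> ('k, 'v) top_module \<Rightarrow> ('k, 'w) top_module \<Rightarrow> ('v \<Rightarrow> 'w) \<Rightarrow> bool"
  where "top_lie_iso K L M f \<longleftrightarrow> lie_hom K L M f \<and> homeomorphic_map (vtop L) (vtop M) f"

definition lie_ideal :: "'k top_ring \<Rightarrow> ('k, 'v) top_module \<Rightarrow> 'v set \<Rightarrow> bool"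
  where "lie_ideal K L I \<longleftrightarrow>
    submodule I K L \<and> (\<forall>x\<in>carrier L. \<forall>y\<in>I. \<^bold>[x, y\<^bold>]\<^bsub>L\<^esub> \<in> I)"

definition restrict_to :: "('k, 'v) top_module \<Rightarrow> 'v set \<Rightarrow> ('k, 'v) top_module"
  where "restrict_to L W = L \<lparr> carrier := W, vtop := subtopology (vtop L) W \<rparr>"

definition center :: "('k, 'v) top_module \<Rightarrow> 'v set"
  where "center L = {z \<in> carrier L. \<forall>x\<in>carrier L. \<^bold>[z, x\<^bold>]\<^bsub>L\<^esub> = \<zero>\<^bsub>L\<^esub>}"

text \<open>
  Endomorphisms of \<open>L\<close> are represented by functions that are \<open>undefined\<close> outside
  \<open>carrier L\<close>, so that equality of functions is equality of endomorphisms.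
\<close>

definition ad :: "('k, 'v) top_module \<Rightarrow> 'v \<Rightarrow> 'v \<Rightarrow> 'v"
  where "ad L x = (\<lambda>y\<in>carrier L. \<^bold>[x, y\<^bold>]\<^bsub>L\<^esub>)"

definition der :: "'k top_ring \<Rightarrow> ('k, 'v) top_module \<Rightarrow> ('k, 'v \<Rightarrow> 'v) module"
  where "der K L =
    \<lparr> carrier = {D \<in> extensional (carrier L). continuous_linear_map K L L D \<and>
        (\<forall>x\<in>carrier L. \<forall>y\<in>carrier L. D \<^bold>[x, y\<^bold>]\<^bsub>L\<^esub> = \<^bold>[D x, y\<^bold>]\<^bsub>L\<^esub> \<oplus>\<^bsub>L\<^esub> \<^bold>[x, D y\<^bold>]\<^bsub>L\<^esub>)},
      mult = (\<lambda>D E. \<lambda>x\<in>carrier L. D (E x) \<ominus>\<^bsub>L\<^esub> E (D x)), one = undefined,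
      zero = (\<lambda>x\<in>carrier L. \<zero>\<^bsub>L\<^esub>), add = (\<lambda>D E. \<lambda>x\<in>carrier L. D x \<oplus>\<^bsub>L\<^esub> E x),
      smult = (\<lambda>a D. \<lambda>x\<in>carrier L. a \<odot>\<^bsub>L\<^esub> D x) \<rparr>"

definition cochains2 ::
  "'k top_ring \<Rightarrow> ('k, 'g) top_module \<Rightarrow> ('k, 'v) top_module \<Rightarrow> ('g \<Rightarrow> 'g \<Rightarrow> 'v) set"
  where "cochains2 K G V = {\<omega>.
    (\<forall>x\<in>carrier G. linear_map K G V (\<omega> x)) \<and>
    (\<forall>y\<in>carrier G. linear_map K G V (\<lambda>x. \<omega> x y)) \<and>
    (\<forall>x\<in>carrier G. \<omega> x x = \<zero>\<^bsub>V\<^esub>) \<and>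
    continuous_map (prod_topology (vtop G) (vtop G)) (vtop V) (\<lambda>(x, y). \<omega> x y)}"


section \<open>Continuous outer actions and kernels\<close>

definition curvature ::
  "'k top_ring \<Rightarrow> ('k, 'g) top_module \<Rightarrow> ('k, 'n) top_module \<Rightarrow> ('g \<Rightarrow> 'n \<Rightarrow> 'n) \<Rightarrow> 'g \<Rightarrow> 'g \<Rightarrow> 'n \<Rightarrow> 'n"
  where "curvature K G N S x y = \<^bold>[S x, S y\<^bold>]\<^bsub>der K N\<^esub> \<ominus>\<^bsub>der K N\<^esub> S \<^bold>[x, y\<^bold>]\<^bsub>G\<^esub>"

definition curvature_cochains ::
  "'k top_ring \<Rightarrow> ('k, 'g) top_module \<Rightarrow> ('k, 'n) top_module \<Rightarrow> ('g \<Rightarrow> 'n \<Rightarrow> 'n) \<Rightarrow> ('g \<Rightarrow> 'g \<Rightarrow> 'n) set"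
  where "curvature_cochains K G N S = {\<omega> \<in> cochains2 K G N.
    \<forall>x\<in>carrier G. \<forall>y\<in>carrier G. curvature K G N S x y = ad N (\<omega> x y)}"

definition continuous_outer_action ::
  "'k top_ring \<Rightarrow> ('k, 'g) top_module \<Rightarrow> ('k, 'n) top_module \<Rightarrow> ('g \<Rightarrow> 'n \<Rightarrow> 'n) \<Rightarrow> bool"
  where "continuous_outer_action K G N S \<longleftrightarrow>
    linear_map K G (der K N) S \<and>
    continuous_map (prod_topology (vtop G) (vtop N)) (vtop N) (\<lambda>(x, n). S x n) \<and>
    curvature_cochains K G N S \<noteq> {}"

definition outer_equivalent ::
  "'k top_ring \<Rightarrow> ('k, 'g) top_module \<Rightarrow> ('k, 'n) top_module \<Rightarrow>
    ('g \<Rightarrow> 'n \<Rightarrow> 'n) \<Rightarrow> ('g \<Rightarrow> 'n \<Rightarrow> 'n) \<Rightarrow> bool"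
  where "outer_equivalent K G N S S' \<longleftrightarrow>
    (\<exists>\<gamma>'. continuous_linear_map K G N \<gamma>' \<and>
      (\<forall>x\<in>carrier G. S x = S' x \<oplus>\<^bsub>der K N\<^esub> ad N (\<gamma>' x)))"

definition kernel_class ::
  "'k top_ring \<Rightarrow> ('k, 'g) top_module \<Rightarrow> ('k, 'n) top_module \<Rightarrow>
    ('g \<Rightarrow> 'n \<Rightarrow> 'n) \<Rightarrow> ('g \<Rightarrow> 'n \<Rightarrow> 'n) set"
  where "kernel_class K G N S =
    {S'. continuous_outer_action K G N S' \<and> outer_equivalent K G N S' S}"


section \<open>Extensions\<close>

text \<open>
  An extension of \<open>G\<close> by \<open>N\<close> is a triple \<open>(H, \<iota>, q)\<close>, where \<open>\<iota>\<close> is the inclusion of \<open>N\<close> as a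
  topological subalgebra of \<open>H\<close>.
\<close>

type_synonym ('k, 'g, 'n, 'h) ext = "('k, 'h) top_module \<times> ('n \<Rightarrow> 'h) \<times> ('h \<Rightarrow> 'g)"

definition is_extension ::
  "'k top_ring \<Rightarrow> ('k, 'g) top_module \<Rightarrow> ('k, 'n) top_module \<Rightarrow> ('k, 'g, 'n, 'h) ext \<Rightarrow> bool"
  where "is_extension K G N = (\<lambda>(H, \<iota>, q).
    topological_lie_algebra K G \<and> topological_lie_algebra K N \<and> topological_lie_algebra K H \<and>
    lie_hom K N H \<iota> \<and> embedding_map (vtop N) (vtop H) \<iota> \<and>
    lie_ideal K H (\<iota> ` carrier N) \<and> topologically_split K H (\<iota> ` carrier N) \<and>
    lie_hom K H G q \<and> quotient_map (vtop H) (vtop G) q \<and>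
    {x \<in> carrier H. q x = \<zero>\<^bsub>G\<^esub>} = \<iota> ` carrier N)"

definition ext_equivalence ::
  "'k top_ring \<Rightarrow> ('k, 'n) top_module \<Rightarrow>
    ('k, 'g, 'n, 'h1) ext \<Rightarrow> ('k, 'g, 'n, 'h2) ext \<Rightarrow> ('h1 \<Rightarrow> 'h2) \<Rightarrow> bool"
  where "ext_equivalence K N = (\<lambda>(H1, \<iota>1, q1) (H2, \<iota>2, q2) \<phi>.
    top_lie_iso K H1 H2 \<phi> \<and>
    (\<forall>n\<in>carrier N. \<phi> (\<iota>1 n) = \<iota>2 n) \<and> (\<forall>x\<in>carrier H1. q2 (\<phi> x) = q1 x))"

definition ext_equivalent ::
  "'k top_ring \<Rightarrow> ('k, 'n) top_module \<Rightarrow>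
    ('k, 'g, 'n, 'h1) ext \<Rightarrow> ('k, 'g, 'n, 'h2) ext \<Rightarrow> bool"
  where "ext_equivalent K N E1 E2 \<longleftrightarrow> (\<exists>\<phi>. ext_equivalence K N E1 E2 \<phi>)"

definition ext_rel ::
  "'k top_ring \<Rightarrow> ('k, 'n) top_module \<Rightarrow> ('k, 'g, 'n, 'h) ext set \<Rightarrow>
    (('k, 'g, 'n, 'h) ext \<times> ('k, 'g, 'n, 'h) ext) set"
  where "ext_rel K N X = {(E1, E2). E1 \<in> X \<and> E2 \<in> X \<and> ext_equivalent K N E1 E2}"

text \<open>The representation \<open>ad\<^sub>\<nn>\<close> of \<open>H\<close> on \<open>N\<close>, transported along the inclusion \<open>\<iota>\<close>.\<close>

definition ad_on ::
  "('k, 'n) top_module \<Rightarrow> ('k, 'h) top_module \<Rightarrow> ('n \<Rightarrow> 'h) \<Rightarrow> 'h \<Rightarrow> 'n \<Rightarrow> 'n"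
  where "ad_on N H \<iota> x = (\<lambda>n\<in>carrier N. inv_into (carrier N) \<iota> \<^bold>[x, \<iota> n\<^bold>]\<^bsub>H\<^esub>)"

definition corresponds_to ::
  "'k top_ring \<Rightarrow> ('k, 'g) top_module \<Rightarrow> ('k, 'n) top_module \<Rightarrow> ('g \<Rightarrow> 'n \<Rightarrow> 'n) \<Rightarrow>
    ('k, 'g, 'n, 'h) ext \<Rightarrow> bool"
  where "corresponds_to K G N S = (\<lambda>(H, \<iota>, q).
    \<exists>\<sigma>. continuous_linear_map K G H \<sigma> \<and> (\<forall>x\<in>carrier G. q (\<sigma> x) = x) \<and>
        kernel_class K G N (\<lambda>x. ad_on N H \<iota> (\<sigma> x)) = kernel_class K G N S)"

text \<open>
  The extensions form a set only after the type \<open>'h\<close> containing their carriers has been fixed.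
  Every extension of \<open>G\<close> by \<open>N\<close> is equivalent to one carried by \<open>carrier N \<times> carrier G\<close>, so a type
  \<open>'h\<close> into which this set embeds gives all classes.
\<close>

definition exts_kernel ::
  "'k top_ring \<Rightarrow> ('k, 'g) top_module \<Rightarrow> ('k, 'n) top_module \<Rightarrow> ('g \<Rightarrow> 'n \<Rightarrow> 'n) \<Rightarrow>
    ('k, 'g, 'n, 'h) ext set"
  where "exts_kernel K G N S = {E. is_extension K G N E \<and> corresponds_to K G N S E}"

definition Ext_rel ::
  "'k top_ring \<Rightarrow> ('k, 'g) top_module \<Rightarrow> ('k, 'n) top_module \<Rightarrow>
    (('k, 'g, 'n, 'h) ext \<times> ('k, 'g, 'n, 'h) ext) set"
  where "Ext_rel K G N = ext_rel K N {E. is_extension K G N E}"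

definition Ext_kernel ::
  "'k top_ring \<Rightarrow> ('k, 'g) top_module \<Rightarrow> ('k, 'n) top_module \<Rightarrow> ('g \<Rightarrow> 'n \<Rightarrow> 'n) \<Rightarrow>
    ('k, 'g, 'n, 'h) ext set set"
  where "Ext_kernel K G N S = {Ext_rel K G N `` {E} | E. E \<in> exts_kernel K G N S}"


section \<open>The Lie algebra associated with an outer action\<close>

text \<open>\<open>\<nn> / \<zz>(\<nn>)\<close>, realised as \<open>ad \<nn>\<close> with the quotient topology coming from \<open>ad\<close>.\<close>

definition n_ad :: "'k top_ring \<Rightarrow> ('k, 'n) top_module \<Rightarrow> ('k, 'n \<Rightarrow> 'n) top_module"
  where "n_ad K N =
    \<lparr> carrier = ad N ` carrier N, mult = mult (der K N), one = undefined,
      zero = zero (der K N), add = add (der K N), smult = smult (der K N),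
      vtop = quotient_topology (vtop N) (ad N) \<rparr>"

text \<open>
  The bracket does not depend on the representatives \<open>n\<close>, \<open>n'\<close> nor on \<open>\<omega>\<close>, hence the
  definite description.
\<close>

definition gS_bracket ::
  "'k top_ring \<Rightarrow> ('k, 'g) top_module \<Rightarrow> ('k, 'n) top_module \<Rightarrow> ('g \<Rightarrow> 'n \<Rightarrow> 'n) \<Rightarrow>
    ('n \<Rightarrow> 'n) \<times> 'g \<Rightarrow> ('n \<Rightarrow> 'n) \<times> 'g \<Rightarrow> ('n \<Rightarrow> 'n) \<times> 'g"
  where "gS_bracket K G N S = (\<lambda>(D, x) (D', x').
    (THE E. \<exists>n\<in>carrier N. \<exists>n'\<in>carrier N. \<exists>\<omega>\<in>curvature_cochains K G N S.
       D = ad N n \<and> D' = ad N n' \<and>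
       E = ad N (\<^bold>[n, n'\<^bold>]\<^bsub>N\<^esub> \<oplus>\<^bsub>N\<^esub> S x n' \<ominus>\<^bsub>N\<^esub> S x' n \<oplus>\<^bsub>N\<^esub> \<omega> x x'),
     \<^bold>[x, x'\<^bold>]\<^bsub>G\<^esub>))"

definition gS ::
  "'k top_ring \<Rightarrow> ('k, 'g) top_module \<Rightarrow> ('k, 'n) top_module \<Rightarrow> ('g \<Rightarrow> 'n \<Rightarrow> 'n) \<Rightarrow>
    ('k, ('n \<Rightarrow> 'n) \<times> 'g) top_module"
  where "gS K G N S =
    \<lparr> carrier = carrier (n_ad K N) \<times> carrier G, mult = gS_bracket K G N S, one = undefined,
      zero = (\<zero>\<^bsub>n_ad K N\<^esub>, \<zero>\<^bsub>G\<^esub>),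
      add = (\<lambda>(D, x) (D', x'). (D \<oplus>\<^bsub>n_ad K N\<^esub> D', x \<oplus>\<^bsub>G\<^esub> x')),
      smult = (\<lambda>a (D, x). (a \<odot>\<^bsub>n_ad K N\<^esub> D, a \<odot>\<^bsub>G\<^esub> x)),
      vtop = prod_topology (vtop (n_ad K N)) (vtop G) \<rparr>"

definition gS_act ::
  "('k, 'n) top_module \<Rightarrow> ('g \<Rightarrow> 'n \<Rightarrow> 'n) \<Rightarrow> ('n \<Rightarrow> 'n) \<times> 'g \<Rightarrow> 'n \<Rightarrow> 'n"
  where "gS_act N S = (\<lambda>(D, x) n. D n \<oplus>\<^bsub>N\<^esub> S x n)"

abbreviation center_algebra :: "('k, 'n) top_module \<Rightarrow> ('k, 'n) top_module"
  where "center_algebra N \<equiv> restrict_to N (center N)"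

definition is_center_extension ::
  "'k top_ring \<Rightarrow> ('k, 'g) top_module \<Rightarrow> ('k, 'n) top_module \<Rightarrow> ('g \<Rightarrow> 'n \<Rightarrow> 'n) \<Rightarrow>
    ('k, ('n \<Rightarrow> 'n) \<times> 'g, 'n, 'h) ext \<Rightarrow> bool"
  where "is_center_extension K G N S = (\<lambda>(H, \<iota>, \<gamma>).
    is_extension K (gS K G N S) (center_algebra N) (H, \<iota>, \<gamma>) \<and>
    (\<forall>x\<in>carrier H. \<forall>z\<in>center N. \<^bold>[x, \<iota> z\<^bold>]\<^bsub>H\<^esub> = \<iota> (gS_act N S (\<gamma> x) z)))"

definition Ext_center_rel ::
  "'k top_ring \<Rightarrow> ('k, 'g) top_module \<Rightarrow> ('k, 'n) top_module \<Rightarrow> ('g \<Rightarrow> 'n \<Rightarrow> 'n) \<Rightarrow>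
    (('k, ('n \<Rightarrow> 'n) \<times> 'g, 'n, 'h) ext \<times> ('k, ('n \<Rightarrow> 'n) \<times> 'g, 'n, 'h) ext) set"
  where "Ext_center_rel K G N S =
    ext_rel K (center_algebra N) {E. is_center_extension K G N S E}"

definition Ext_center ::
  "'k top_ring \<Rightarrow> ('k, 'g) top_module \<Rightarrow> ('k, 'n) top_module \<Rightarrow> ('g \<Rightarrow> 'n \<Rightarrow> 'n) \<Rightarrow>
    ('k, ('n \<Rightarrow> 'n) \<times> 'g, 'n, 'h) ext set set"
  where "Ext_center K G N S =
    {E. is_center_extension K G N S E} // Ext_center_rel K G N S"

definition gamma ::
  "'k top_ring \<Rightarrow> ('k, 'n) top_module \<Rightarrow> ('g \<Rightarrow> 'n \<Rightarrow> 'n) \<Rightarrow> ('k, 'g, 'n, 'h) ext \<Rightarrow>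
    'h \<Rightarrow> ('n \<Rightarrow> 'n) \<times> 'g"
  where "gamma K N S = (\<lambda>(H, \<iota>, q) x. (ad_on N H \<iota> x \<ominus>\<^bsub>der K N\<^esub> S (q x), q x))"

definition associated_ext ::
  "'k top_ring \<Rightarrow> ('k, 'n) top_module \<Rightarrow> ('g \<Rightarrow> 'n \<Rightarrow> 'n) \<Rightarrow> ('k, 'g, 'n, 'h) ext \<Rightarrow>
    ('k, ('n \<Rightarrow> 'n) \<times> 'g, 'n, 'h) ext"
  where "associated_ext K N S = (\<lambda>(H, \<iota>, q). (H, restrict \<iota> (center N), gamma K N S (H, \<iota>, q)))"

definition comes_from_extension ::
  "'k top_ring \<Rightarrow> ('k, 'g) top_module \<Rightarrow> ('k, 'n) top_module \<Rightarrow> ('g \<Rightarrow> 'n \<Rightarrow> 'n) \<Rightarrow>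
    ('k, ('n \<Rightarrow> 'n) \<times> 'g, 'n, 'h) ext \<Rightarrow> bool"
  where "comes_from_extension K G N S = (\<lambda>(H, \<iota>, \<gamma>).
    \<exists>\<iota>' q. (H, \<iota>', q) \<in> exts_kernel K G N S \<and>
      (\<forall>z\<in>center N. \<iota>' z = \<iota> z) \<and> (\<forall>x\<in>carrier H. \<gamma> x = gamma K N S (H, \<iota>', q) x))"

text \<open>The subalgebra \<open>\<gamma>\<^sup>-\<^sup>1(\<nn>\<^sub>a\<^sub>d)\<close>, where \<open>\<nn>\<^sub>a\<^sub>d\<close> is identified with \<open>\<nn>\<^sub>a\<^sub>d \<times> {0}\<close>.\<close>

definition preimage_n_ad ::
  "'k top_ring \<Rightarrow> ('k, 'g) top_module \<Rightarrow> ('k, 'n) top_module \<Rightarrow> ('k, 'h) top_module \<Rightarrow>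
    ('h \<Rightarrow> ('n \<Rightarrow> 'n) \<times> 'g) \<Rightarrow> ('k, 'h) top_module"
  where "preimage_n_ad K G N H \<gamma> =
    restrict_to H {x \<in> carrier H. \<gamma> x \<in> carrier (n_ad K N) \<times> {\<zero>\<^bsub>G\<^esub>}}"

text \<open>
  Equivalences from the central extension \<open>ad : \<nn> \<rightarrow> \<nn>\<^sub>a\<^sub>d\<close> to \<open>\<gamma>\<^sup>-\<^sup>1(\<nn>\<^sub>a\<^sub>d) \<rightarrow> \<nn>\<^sub>a\<^sub>d\<close> that commute
  with the action of \<open>\<gg>\<^sup>S\<close>. An element \<open>s\<close> of \<open>\<gg>\<^sup>S\<close> acts on \<open>\<gamma>\<^sup>-\<^sup>1(\<nn>\<^sub>a\<^sub>d)\<close> as \<open>ad x\<close> for any \<open>x\<close>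
  with \<open>\<gamma> x = s\<close>; since \<open>\<gamma>\<close> is onto, letting \<open>x\<close> range over \<open>H\<close> covers all of \<open>\<gg>\<^sup>S\<close>.
\<close>

definition equivariant_equivalence ::
  "'k top_ring \<Rightarrow> ('k, 'g) top_module \<Rightarrow> ('k, 'n) top_module \<Rightarrow> ('g \<Rightarrow> 'n \<Rightarrow> 'n) \<Rightarrow>
    ('k, ('n \<Rightarrow> 'n) \<times> 'g, 'n, 'h) ext \<Rightarrow> ('n \<Rightarrow> 'h) \<Rightarrow> bool"
  where "equivariant_equivalence K G N S = (\<lambda>(H, \<iota>, \<gamma>) \<alpha>.
    ext_equivalence K (center_algebra N)
      (N, \<lambda>z. z, ad N) (preimage_n_ad K G N H \<gamma>, \<iota>, \<lambda>x. fst (\<gamma> x)) \<alpha> \<and>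
    (\<forall>x\<in>carrier H. \<forall>n\<in>carrier N. \<alpha> (gS_act N S (\<gamma> x) n) = \<^bold>[x, \<alpha> n\<^bold>]\<^bsub>H\<^esub>))"

end

theory Submission
  imports Defs "HOL-Analysis.Abstract_Topological_Spaces"
begin

text \<open>
  The outer action can be realised exactly: if \<open>S\<close> is equivalent to \<open>ad \<circ> \<sigma>\<^sub>0\<close> for a section
  \<open>\<sigma>\<^sub>0\<close> of \<open>q\<close>, with difference \<open>ad \<circ> \<gamma>'\<close>, then \<open>\<sigma> = \<sigma>\<^sub>0 + \<gamma>'\<close> is a section whose action on
  \<open>\<nn>\<close> is \<open>S\<close> itself. Writing the elements of the extension as \<open>n + \<sigma> x\<close>, the map \<open>\<gamma>\<close> becomes
  \<open>n + \<sigma> x \<mapsto> (ad n, x)\<close>, from which its kernel, its continuity and a continuous section can be read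
  off. Conversely, an equivariant equivalence \<open>\<alpha>\<close> serves as the inclusion of \<open>\<nn>\<close>, the
  map \<open>q\<close> is the second component of \<open>\<gamma>\<close>, and \<open>\<sigma> x = \<tau> (0, x)\<close> for a linear section \<open>\<tau>\<close> of \<open>\<gamma>\<close>.
\<close>

section \<open>Topological vector spaces\<close>

text \<open>The splitting of the centre enters through a projection \<open>P\<close> of
  \<open>N\<close> onto \<open>center N\<close>. The map \<open>n \<mapsto> n - P n\<close> is
  constant on the fibres of \<open>ad N\<close>, so it induces a continuous section of
  \<open>ad N\<close> for the quotient topology; together with \<sigma> it gives a continuous
  section of \<gamma>. Composing \<open>P\<close> with the \<open>N\<close>-coordinate gives the
  retraction onto the centre. For the bracket, the \<open>N\<close>-coordinate of
  \<open>[\<sigma> x, \<sigma> y]\<close> need not be \<omega>(x, y). Both elements act on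
  \<open>N\<close> as the curvature of \<open>S\<close>, so they differ by a central element, and
  \<gamma> sees only their images under \<open>ad N\<close>. In the converse, (0, x) acts on
  \<open>N\<close> exactly as \<open>S x\<close>. Equivariance of \<alpha> therefore says that
  lifting (0, x) to the extension gives a section that realises \<open>S\<close> itself, and it also
  forces the first component of \<gamma> to be the adjoint action minus \<open>S\<close>.\<close>

lemma (in abelian_group) r_neg_middle:
  assumes "x \<in> carrier G" "y \<in> carrier G" "z \<in> carrier G"
  shows "x \<oplus> (y \<oplus> (\<ominus> x \<oplus> z)) = y \<oplus> z"
proof -
  have "x \<oplus> (y \<oplus> (\<ominus> x \<oplus> z)) = y \<oplus> (x \<oplus> (\<ominus> x \<oplus> z))"
    using assms by (simp add: a_lcomm)
  then show ?thesis using assms by (simp add: r_neg1 r_neg2)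
qed

lemma (in abelian_group) a_inv_zero [simp]: "\<ominus> \<zero> = \<zero>"
  by (rule minus_equality) simp_all

text \<open>Sorting a sum with \<open>a_ac\<close> can leave a term and its negative separated by
  another summand. This law and \<open>r_neg_middle\<close> perform the cancellations that the
  adjacent forms \<open>r_neg1\<close> and \<open>r_neg2\<close> then miss.\<close>

lemma (in abelian_group) r_neg_last:
  assumes "x \<in> carrier G" "y \<in> carrier G"
  shows "x \<oplus> (y \<oplus> \<ominus> x) = y"
  using assms by (simp add: a_lcomm[of x y] r_neg)

context topological_vector_space
begin

lemma continuous_map_vadd:
  assumes "continuous_map X (vtop V) f" "continuous_map X (vtop V) g"
  shows "continuous_map X (vtop V) (\<lambda>x. f x \<oplus>\<^bsub>V\<^esub> g x)"
  using continuous_map_compose[OF continuous_map_pairedI[OF assms] continuous_vadd]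
  by (simp add: o_def)

lemma continuous_map_smult:
  assumes "continuous_map X (ring_top K) c" "continuous_map X (vtop V) f"
  shows "continuous_map X (vtop V) (\<lambda>x. c x \<odot>\<^bsub>V\<^esub> f x)"
  using continuous_map_compose[OF continuous_map_pairedI[OF assms] continuous_smult]
  by (simp add: o_def)

lemma continuous_map_vminus:
  assumes "continuous_map X (vtop V) f" "continuous_map X (vtop V) g"
  shows "continuous_map X (vtop V) (\<lambda>x. f x \<ominus>\<^bsub>V\<^esub> g x)"
proof -
  \<comment> \<open>Continuity of negation is not among the axioms for \<open>V\<close>; it is
    obtained from scalar multiplication by the constant -1.\<close>
  have c: "continuous_map X (ring_top K) (\<lambda>x. \<ominus>\<^bsub>K\<^esub> \<one>\<^bsub>K\<^esub>)"
    by (simp add: topspace_ring)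
  have "continuous_map X (vtop V) (\<lambda>x. f x \<oplus>\<^bsub>V\<^esub> (\<ominus>\<^bsub>K\<^esub> \<one>\<^bsub>K\<^esub>) \<odot>\<^bsub>V\<^esub> g x)"
    by (intro continuous_map_vadd continuous_map_smult assms c)
  moreover have "g x \<in> carrier V" if "x \<in> topspace X" for x
    using continuous_map_image_subset_topspace[OF assms(2)] that by (auto simp: topspace_vtop)
  ultimately show ?thesis
    by (elim continuous_map_eq) (simp add: smult_l_minus a_minus_def)
qed

lemma vminus_add_cancel: "x \<in> carrier V \<Longrightarrow> y \<in> carrier V \<Longrightarrow> y \<oplus>\<^bsub>V\<^esub> (x \<ominus>\<^bsub>V\<^esub> y) = x"
  by (simp add: a_minus_def M.a_ac M.r_neg)
end

section \<open>Topologically split subspaces as ranges of continuous projections\<close>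

lemma submodule_additive_subgroup: "submodule W K V \<Longrightarrow> additive_subgroup W V"
  by (simp add: additive_subgroup_def submodule_def)

text \<open>A form of \<open>topologically_split\<close> that avoids cosets. For a submodule of a
  topological vector space the two are shown below to imply each other.\<close>

definition continuous_linear_projection ::
  "'k top_ring \<Rightarrow> ('k, 'v) top_module \<Rightarrow> 'v set \<Rightarrow> ('v \<Rightarrow> 'v) \<Rightarrow> bool"
  where "continuous_linear_projection K V W P \<longleftrightarrow>
    continuous_linear_map K V V P \<and> P \<in> carrier V \<rightarrow> W \<and> (\<forall>w\<in>W. P w = w)"

context topological_vector_space
begin

context
  fixes W assumes sub: "submodule W K V"
begin

interpretation W: abelian_subgroup W V
  by (rule abelian_subgroupI3) (use sub submodule_additive_subgroup in \<open>auto intro: abelian_group_axioms\<close>)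

lemma coset_eq_iff:
  assumes "x \<in> carrier V" "y \<in> carrier V"
  shows "W +>\<^bsub>V\<^esub> x = W +>\<^bsub>V\<^esub> y \<longleftrightarrow> x \<ominus>\<^bsub>V\<^esub> y \<in> W"
proof 
  assume "W +>\<^bsub>V\<^esub> x = W +>\<^bsub>V\<^esub> y"
  then show "x \<ominus>\<^bsub>V\<^esub> y \<in> W"
    using W.a_rcos_module_imp[of y x] W.a_rcos_self[of x] assms by (simp add: a_minus_def)
next
  assume "x \<ominus>\<^bsub>V\<^esub> y \<in> W"
  then have "x \<in> W +>\<^bsub>V\<^esub> y"
    using W.a_rcos_module_rev assms by (simp add: a_minus_def)
  then show "W +>\<^bsub>V\<^esub> x = W +>\<^bsub>V\<^esub> y"
    using assms W.a_subset W.a_subgroup  M.a_repr_independence by metis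
qed

lemma quotient_space_add:
  assumes "x \<in> carrier V" "y \<in> carrier V"
  shows "(W +>\<^bsub>V\<^esub> x) \<oplus>\<^bsub>quotient_space V W\<^esub> (W +>\<^bsub>V\<^esub> y) = W +>\<^bsub>V\<^esub> (x \<oplus>\<^bsub>V\<^esub> y)"
  using assms by (simp add: quotient_space_def W.a_rcos_sum)

lemma quotient_space_smult:
  assumes "a \<in> carrier K" "x \<in> carrier V"
  shows "a \<odot>\<^bsub>quotient_space V W\<^esub> (W +>\<^bsub>V\<^esub> x) = W +>\<^bsub>V\<^esub> (a \<odot>\<^bsub>V\<^esub> x)"
proof -
  have W: "w \<in> carrier V" if "w \<in> W" for w using W.a_subset that by auto
  have sW: "a \<odot>\<^bsub>V\<^esub> w \<in> W" if "w \<in> W" for w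
    using that assms sub by (simp add: submodule.smult_closed)
  have "W <+>\<^bsub>V\<^esub> (\<lambda>x. a \<odot>\<^bsub>V\<^esub> x) ` (W +>\<^bsub>V\<^esub> x) = W +>\<^bsub>V\<^esub> (a \<odot>\<^bsub>V\<^esub> x)"
  proof
    show "W <+>\<^bsub>V\<^esub> (\<lambda>x. a \<odot>\<^bsub>V\<^esub> x) ` (W +>\<^bsub>V\<^esub> x) \<subseteq> W +>\<^bsub>V\<^esub> (a \<odot>\<^bsub>V\<^esub> x)"
    proof (clarsimp simp: set_add_def' a_r_coset_def')
      fix w w' assume w: "w \<in> W" "w' \<in> W"
      then show "\<exists>h\<in>W. w \<oplus>\<^bsub>V\<^esub> a \<odot>\<^bsub>V\<^esub> (w' \<oplus>\<^bsub>V\<^esub> x) = h \<oplus>\<^bsub>V\<^esub> a \<odot>\<^bsub>V\<^esub> x"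
        using assms W sW by (intro bexI[of _ "w \<oplus>\<^bsub>V\<^esub> a \<odot>\<^bsub>V\<^esub> w'"]) (auto simp: smult_r_distr M.a_assoc)
    qed
    show "W +>\<^bsub>V\<^esub> (a \<odot>\<^bsub>V\<^esub> x) \<subseteq> W <+>\<^bsub>V\<^esub> (\<lambda>x. a \<odot>\<^bsub>V\<^esub> x) ` (W +>\<^bsub>V\<^esub> x)"
    proof (clarsimp simp: set_add_def' a_r_coset_def')
      fix w assume w: "w \<in> W"
      show "\<exists>h\<in>W. \<exists>k\<in>W. w \<oplus>\<^bsub>V\<^esub> a \<odot>\<^bsub>V\<^esub> x = h \<oplus>\<^bsub>V\<^esub> a \<odot>\<^bsub>V\<^esub> (k \<oplus>\<^bsub>V\<^esub> x)"
        using w assms by (intro bexI[of _ w] bexI[of _ "\<zero>\<^bsub>V\<^esub>"]) auto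
    qed
  qed
  then show ?thesis by (simp add: quotient_space_def)
qed

lemma carrier_quotient_space: "carrier (quotient_space V W) = (\<lambda>x. W +>\<^bsub>V\<^esub> x) ` carrier V"
  by (auto simp: quotient_space_def A_RCOSETS_def')

lemma quotient_map_coset: "quotient_map (vtop V) (vtop (quotient_space V W)) (\<lambda>x. W +>\<^bsub>V\<^esub> x)"
  by (simp add: quotient_space_def quotient_map_quotient_topology)

text \<open>The projection is x - \<sigma>(W + x). It takes values in \<open>W\<close> because
  \<sigma> picks an element of the same coset, and it fixes \<open>W\<close> because a linear
  \<sigma> sends the zero coset to 0.\<close>

lemma projection_of_topologically_split:
  assumes "topologically_split K V W"
  shows "\<exists>P. continuous_linear_projection K V W P"
proof -
  obtain \<sigma> where \<sigma>: "continuous_linear_map K (quotient_space V W) V \<sigma>"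
    and sec: "\<And>x. x \<in> carrier V \<Longrightarrow> W +>\<^bsub>V\<^esub> \<sigma> (W +>\<^bsub>V\<^esub> x) = W +>\<^bsub>V\<^esub> x"
    using assms unfolding topologically_split_def carrier_quotient_space by blast
  let ?t = "\<lambda>x. \<sigma> (W +>\<^bsub>V\<^esub> x)"
  have t: "?t x \<in> carrier V" if "x \<in> carrier V" for x
    using \<sigma> that by (auto simp: continuous_linear_map_def linear_map_def carrier_quotient_space)
  have tadd: "?t (x \<oplus>\<^bsub>V\<^esub> y) = ?t x \<oplus>\<^bsub>V\<^esub> ?t y" if "x \<in> carrier V" "y \<in> carrier V" for x y
    using \<sigma> that by (simp add: continuous_linear_map_def linear_map_def carrier_quotient_space
      flip: quotient_space_add)
  have tsm: "?t (a \<odot>\<^bsub>V\<^esub> x) = a \<odot>\<^bsub>V\<^esub> ?t x" if "a \<in> carrier K" "x \<in> carrier V" for x a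
    using \<sigma> that by (simp add: continuous_linear_map_def linear_map_def carrier_quotient_space
      flip: quotient_space_smult)
  have t0: "?t w = \<zero>\<^bsub>V\<^esub>" if "w \<in> W" for w
  proof -
    have w: "w \<in> carrier V" using that W.a_subset by auto
    have "W +>\<^bsub>V\<^esub> w = W +>\<^bsub>V\<^esub> \<zero>\<^bsub>V\<^esub>"
      using that w by (subst coset_eq_iff) (auto simp: a_minus_def)
    moreover have "?t \<zero>\<^bsub>V\<^esub> = \<zero>\<^bsub>V\<^esub>"
      using tsm[of "\<zero>\<^bsub>K\<^esub>" "\<zero>\<^bsub>V\<^esub>"] t by simp
    ultimately show ?thesis by simp
  qed
  have ct: "continuous_map (vtop V) (vtop V) ?t"
    using continuous_map_compose[OF quotient_imp_continuous_map[OF quotient_map_coset]] \<sigma>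
    by (auto simp: continuous_linear_map_def o_def)
  define P where "P = (\<lambda>x. x \<ominus>\<^bsub>V\<^esub> ?t x)"
  have "continuous_map (vtop V) (vtop V) P"
    unfolding P_def by (intro continuous_map_vminus ct) auto
  moreover have "linear_map K V V P"
    using t by (auto simp: linear_map_def P_def tadd tsm a_minus_def M.minus_add M.a_ac
        smult_r_distr smult_r_minus)
  moreover have "P \<in> carrier V \<rightarrow> W"
    using sec[symmetric] t by (auto simp: P_def coset_eq_iff)
  moreover have "P w = w" if "w \<in> W" for w
    using t0[OF that] that W.a_subset by (auto simp: P_def a_minus_def)
  ultimately show ?thesis
    by (auto simp: continuous_linear_projection_def continuous_linear_map_def)
qed

text \<open>The complementary map \<open>?Q\<close> = id - P vanishes on \<open>W\<close>, so it
  descends to the quotient and gives the section there. The inverse of the addition map is x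
  \<mapsto> (P x, W + x).\<close>

lemma topologically_split_of_projection:
  assumes "continuous_linear_projection K V W P"
  shows "topologically_split K V W"
proof -
  have P: "linear_map K V V P" "continuous_map (vtop V) (vtop V) P"
    and PW: "\<And>x. x \<in> carrier V \<Longrightarrow> P x \<in> W" and Pid: "\<And>w. w \<in> W \<Longrightarrow> P w = w"
    using assms by (auto simp: continuous_linear_projection_def continuous_linear_map_def)
  have WV: "w \<in> carrier V" if "w \<in> W" for w using that W.a_subset by auto
  \<comment> \<open>\<open>W\<close> is the set where \<open>P\<close> and the identity agree, which
    is closed because \<open>V\<close> is Hausdorff.\<close>
  have W_eq: "W = {x \<in> topspace (vtop V). P x = x}"
    using PW Pid WV by (force simp: topspace_vtop)
  have cl: "closedin (vtop V) W"
    by (subst W_eq) (intro closedin_continuous_maps_eq[OF Hausdorff_vtop] P continuous_map_id[unfolded id_def])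
  let ?Q = "\<lambda>x. x \<ominus>\<^bsub>V\<^esub> P x"
  \<comment> \<open>The coset representative is arbitrary: two choices differ by an element of
    \<open>W\<close>, which \<open>?Q\<close> kills.\<close>
  define \<sigma> where "\<sigma> A = ?Q (SOME x. x \<in> carrier V \<and> A = W +>\<^bsub>V\<^esub> x)" for A
  have Padd: "P (x \<oplus>\<^bsub>V\<^esub> y) = P x \<oplus>\<^bsub>V\<^esub> P y" if "x \<in> carrier V" "y \<in> carrier V" for x y
    using P that by (auto simp: linear_map_def)
  have Psm: "P (a \<odot>\<^bsub>V\<^esub> x) = a \<odot>\<^bsub>V\<^esub> P x" if "a \<in> carrier K" "x \<in> carrier V" for x a
    using P that by (auto simp: linear_map_def)
  have Pc: "P x \<in> carrier V" if "x \<in> carrier V" for x using PW WV that by auto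
  have \<sigma>: "\<sigma> (W +>\<^bsub>V\<^esub> x) = ?Q x" if x: "x \<in> carrier V" for x
  proof -
    define y where "y = (SOME y. y \<in> carrier V \<and> W +>\<^bsub>V\<^esub> x = W +>\<^bsub>V\<^esub> y)"
    have y: "y \<in> carrier V" "W +>\<^bsub>V\<^esub> x = W +>\<^bsub>V\<^esub> y"
      unfolding y_def using someI[of "\<lambda>y. y \<in> carrier V \<and> W +>\<^bsub>V\<^esub> x = W +>\<^bsub>V\<^esub> y" x] x by auto
    define w where "w = x \<ominus>\<^bsub>V\<^esub> y"
    have w: "w \<in> W" using coset_eq_iff x y by (simp add: w_def)
    have xeq: "x = w \<oplus>\<^bsub>V\<^esub> y" 
      using x y by (simp add: w_def a_minus_def M.a_assoc M.l_neg)
    have "?Q x = ?Q y"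
      unfolding xeq using w y WV Pc by (simp add: Padd Pid a_minus_def M.minus_add M.a_ac M.r_neg_middle)
    then show ?thesis by (simp add: \<sigma>_def y_def)
  qed
  have "linear_map K (quotient_space V W) V \<sigma>"
    unfolding linear_map_def carrier_quotient_space
    by (auto simp: \<sigma> quotient_space_add quotient_space_smult Pc Padd Psm a_minus_def M.minus_add M.a_ac
        smult_r_distr smult_r_minus)
  moreover have c\<sigma>: "continuous_map (vtop (quotient_space V W)) (vtop V) \<sigma>"
  proof (rule continuous_compose_quotient_map[OF quotient_map_coset])
    have "continuous_map (vtop V) (vtop V) ?Q"
      by (intro continuous_map_vminus P) auto
    then show "continuous_map (vtop V) (vtop V) (\<sigma> \<circ> (\<lambda>x. W +>\<^bsub>V\<^esub> x))"
      by (rule continuous_map_eq) (simp add: \<sigma> topspace_vtop)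
  qed
  moreover have "W +>\<^bsub>V\<^esub> \<sigma> A = A" if "A \<in> carrier (quotient_space V W)" for A
  proof -
    obtain x where x: "x \<in> carrier V" "A = W +>\<^bsub>V\<^esub> x" using \<open>A \<in> _\<close> by (auto simp: carrier_quotient_space)
    have "?Q x \<ominus>\<^bsub>V\<^esub> x = \<ominus>\<^bsub>V\<^esub> P x" 
      using x Pc by (simp add: a_minus_def M.a_ac M.r_neg1 M.r_neg2 M.r_neg)
    then show ?thesis using x Pc PW by (simp add: \<sigma> coset_eq_iff)
  qed
  moreover have "homeomorphic_maps
           (prod_topology (subtopology (vtop V) W) (vtop (quotient_space V W))) (vtop V)
           (\<lambda>(w, A). w \<oplus>\<^bsub>V\<^esub> \<sigma> A) (\<lambda>x. (P x, W +>\<^bsub>V\<^esub> x))"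
    unfolding homeomorphic_maps_def
  proof (intro conjI)
    show "continuous_map (prod_topology (subtopology (vtop V) W) (vtop (quotient_space V W))) (vtop V)
           (\<lambda>(w, A). w \<oplus>\<^bsub>V\<^esub> \<sigma> A)"
      unfolding case_prod_unfold
      by (intro continuous_map_vadd continuous_map_compose[OF _ c\<sigma>, unfolded o_def]
          continuous_map_snd continuous_map_into_fulltopology[OF continuous_map_fst])
    show "continuous_map (vtop V) (prod_topology (subtopology (vtop V) W) (vtop (quotient_space V W)))
           (\<lambda>x. (P x, W +>\<^bsub>V\<^esub> x))"
      by (intro continuous_map_pairedI quotient_imp_continuous_map[OF quotient_map_coset]
           continuous_map_into_subtopology P) (auto simp: topspace_vtop PW)
    have ts: "topspace (vtop (quotient_space V W)) = (\<lambda>x. W +>\<^bsub>V\<^esub> x) ` carrier V"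
      by (simp add: quotient_space_def topspace_quotient_topology topspace_vtop)
    show "\<forall>x\<in>topspace (prod_topology (subtopology (vtop V) W) (vtop (quotient_space V W))).
       (P ((\<lambda>(w, A). w \<oplus>\<^bsub>V\<^esub> \<sigma> A) x), W +>\<^bsub>V\<^esub> (\<lambda>(w, A). w \<oplus>\<^bsub>V\<^esub> \<sigma> A) x) = x"
    proof (clarsimp simp: ts topspace_vtop \<sigma>)
      fix w x assume w: "w \<in> W" and x: "x \<in> carrier V"
      have "P (w \<oplus>\<^bsub>V\<^esub> ?Q x) = w"
      proof -
        have "P (?Q x) = \<zero>\<^bsub>V\<^esub>"
          using x Pc PW by (simp add: a_minus_def Padd Pid M.r_neg)
        then show ?thesis using w x Pc WV Pid Padd by simp
      qed
      moreover have "W +>\<^bsub>V\<^esub> (w \<oplus>\<^bsub>V\<^esub> ?Q x) = W +>\<^bsub>V\<^esub> x"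
      proof -
        have "(w \<oplus>\<^bsub>V\<^esub> ?Q x) \<ominus>\<^bsub>V\<^esub> x = w \<oplus>\<^bsub>V\<^esub> \<ominus>\<^bsub>V\<^esub> P x"
          using x w Pc WV by (simp add: a_minus_def M.a_ac M.r_neg1 M.r_neg2 M.r_neg)
        then show ?thesis using x w Pc WV PW by (simp add: coset_eq_iff)
      qed
      ultimately show "P (w \<oplus>\<^bsub>V\<^esub> ?Q x) = w \<and> W +>\<^bsub>V\<^esub> (w \<oplus>\<^bsub>V\<^esub> ?Q x) = W +>\<^bsub>V\<^esub> x" by simp
    qed
    show "\<forall>x\<in>topspace (vtop V). (\<lambda>(w, A). w \<oplus>\<^bsub>V\<^esub> \<sigma> A) (P x, W +>\<^bsub>V\<^esub> x) = x"
      using Pc by (simp add: topspace_vtop \<sigma> vminus_add_cancel)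
  qed
  ultimately show ?thesis
    using cl sub unfolding topologically_split_def continuous_linear_map_def homeomorphic_map_maps by blast
qed

end

end

section \<open>Algebra of continuous linear maps\<close>

lemma linear_map_closed: "linear_map K V W f \<Longrightarrow> x \<in> carrier V \<Longrightarrow> f x \<in> carrier W"
  and linear_map_add: "linear_map K V W f \<Longrightarrow> x \<in> carrier V \<Longrightarrow> y \<in> carrier V \<Longrightarrow>
    f (x \<oplus>\<^bsub>V\<^esub> y) = f x \<oplus>\<^bsub>W\<^esub> f y"
  and linear_map_smult: "linear_map K V W f \<Longrightarrow> a \<in> carrier K \<Longrightarrow> x \<in> carrier V \<Longrightarrow>
    f (a \<odot>\<^bsub>V\<^esub> x) = a \<odot>\<^bsub>W\<^esub> f x"
  by (auto simp: linear_map_def)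

lemma linear_map_zero:
  assumes "Module.module K V" "Module.module K W" "linear_map K V W f"
  shows "f \<zero>\<^bsub>V\<^esub> = \<zero>\<^bsub>W\<^esub>"
proof -
  interpret V: Module.module K V by fact
  interpret W: Module.module K W by fact
  have "f (\<zero>\<^bsub>K\<^esub> \<odot>\<^bsub>V\<^esub> \<zero>\<^bsub>V\<^esub>) = \<zero>\<^bsub>K\<^esub> \<odot>\<^bsub>W\<^esub> f \<zero>\<^bsub>V\<^esub>"
    using assms(3) by (intro linear_map_smult) auto
  then show ?thesis using linear_map_closed[OF assms(3)] by simp
qed

lemma linear_map_uminus:
  assumes "Module.module K V" "Module.module K W" "linear_map K V W f" "x \<in> carrier V"
  shows "f (\<ominus>\<^bsub>V\<^esub> x) = \<ominus>\<^bsub>W\<^esub> f x"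
proof -
  interpret V: Module.module K V by fact
  interpret W: Module.module K W by fact
  have fx: "f x \<in> carrier W" using assms linear_map_closed by metis
  have "f ((\<ominus>\<^bsub>K\<^esub> \<one>\<^bsub>K\<^esub>) \<odot>\<^bsub>V\<^esub> x) = (\<ominus>\<^bsub>K\<^esub> \<one>\<^bsub>K\<^esub>) \<odot>\<^bsub>W\<^esub> f x"
    using assms(3,4) by (intro linear_map_smult) auto
  then show ?thesis using fx assms(4) by (simp add: V.smult_l_minus W.smult_l_minus)
qed

lemma linear_map_minus:
  assumes "Module.module K V" "Module.module K W" "linear_map K V W f" "x \<in> carrier V" "y \<in> carrier V"
  shows "f (x \<ominus>\<^bsub>V\<^esub> y) = f x \<ominus>\<^bsub>W\<^esub> f y"
proof -
  interpret V: Module.module K V by fact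
  show ?thesis using assms
    by (simp add: a_minus_def linear_map_uminus[OF assms(1-3)] linear_map_add[OF assms(3)])
qed

lemma linear_map_comp:
  "linear_map K U V f \<Longrightarrow> linear_map K V W g \<Longrightarrow> linear_map K U W (\<lambda>x. g (f x))"
  by (auto simp: linear_map_def Pi_iff)

lemma continuous_linear_map_comp:
  "continuous_linear_map K U V f \<Longrightarrow> continuous_linear_map K V W g \<Longrightarrow>
    continuous_linear_map K U W (\<lambda>x. g (f x))"
  unfolding continuous_linear_map_def
  using linear_map_comp continuous_map_compose[unfolded o_def] by blast

lemma submodule_kernel:
  assumes "Module.module K V" "Module.module K W" "linear_map K V W f"
  shows "submodule {x \<in> carrier V. f x = \<zero>\<^bsub>W\<^esub>} K V"
proof -
  interpret V: Module.module K V by fact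
  interpret W: Module.module K W by fact
  show ?thesis
    by (rule V.submoduleI)
      (auto simp: linear_map_zero[OF assms] linear_map_uminus[OF assms] linear_map_add[OF assms(3)]
        linear_map_smult[OF assms(3)])
qed

context topological_vector_space
begin

lemma is_module: "Module.module K V" ..

lemma continuous_linear_map_zero_map: "continuous_linear_map K U V (\<lambda>x. \<zero>\<^bsub>V\<^esub>)"
  by (auto simp: continuous_linear_map_def linear_map_def topspace_vtop)

lemma continuous_linear_map_vadd:
  assumes "continuous_linear_map K U V f" "continuous_linear_map K U V g"
  shows "continuous_linear_map K U V (\<lambda>x. f x \<oplus>\<^bsub>V\<^esub> g x)"
  using assms unfolding continuous_linear_map_def linear_map_def Pi_iff
  by (simp add: continuous_map_vadd M.a_ac smult_r_distr)

lemma continuous_linear_map_vminus: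
  assumes "continuous_linear_map K U V f" "continuous_linear_map K U V g"
  shows "continuous_linear_map K U V (\<lambda>x. f x \<ominus>\<^bsub>V\<^esub> g x)"
  using assms unfolding continuous_linear_map_def linear_map_def Pi_iff
  by (simp add: continuous_map_vminus[unfolded a_minus_def] a_minus_def M.minus_add M.a_ac
      smult_r_distr smult_r_minus)

lemma continuous_linear_map_id: "continuous_linear_map K V V (\<lambda>x. x)"
  by (auto simp: continuous_linear_map_def linear_map_def)

end

section \<open>Topological Lie algebras\<close>

context topological_lie_algebra
begin

abbreviation br :: "'v \<Rightarrow> 'v \<Rightarrow> 'v" where "br x y \<equiv> \<^bold>[x, y\<^bold>]\<^bsub>L\<^esub>"

lemma continuous_map_bracket:
  assumes "continuous_map X (vtop L) f" "continuous_map X (vtop L) g"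
  shows "continuous_map X (vtop L) (\<lambda>x. br (f x) (g x))"
  using continuous_map_compose[OF continuous_map_pairedI[OF assms] continuous_bracket]
  by (simp add: o_def)

lemma linear_map_bracket_right: "x \<in> carrier L \<Longrightarrow> linear_map K L L (\<lambda>y. br x y)"
  by (auto simp: linear_map_def bracket_closed bracket_add_right bracket_smult_right)

lemma linear_map_bracket_left: "y \<in> carrier L \<Longrightarrow> linear_map K L L (\<lambda>x. br x y)"
  by (auto simp: linear_map_def bracket_closed bracket_add_left bracket_smult_left)

lemmas bracket_zero_right = linear_map_zero[OF is_module is_module linear_map_bracket_right]
lemmas bracket_zero_left = linear_map_zero[OF is_module is_module linear_map_bracket_left]
lemmas bracket_uminus_right = linear_map_uminus[OF is_module is_module linear_map_bracket_right]
lemmas bracket_uminus_left = linear_map_uminus[OF is_module is_module linear_map_bracket_left]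
lemmas bracket_minus_left = linear_map_minus[OF is_module is_module linear_map_bracket_left]

lemma bracket_skew:
  assumes "x \<in> carrier L" "y \<in> carrier L"
  shows "br y x = \<ominus>\<^bsub>L\<^esub> br x y"
proof -
  have "br (x \<oplus>\<^bsub>L\<^esub> y) (x \<oplus>\<^bsub>L\<^esub> y) = \<zero>\<^bsub>L\<^esub>" using assms by (simp add: bracket_self)
  then have "br y x \<oplus>\<^bsub>L\<^esub> br x y = \<zero>\<^bsub>L\<^esub>"
    using assms
    by (simp add: bracket_add_left bracket_add_right bracket_self[of x] bracket_self[of y]
        bracket_closed M.a_comm)
  then show ?thesis using assms bracket_closed M.minus_equality[symmetric] by metis
qed

lemma jacobi_leibniz:
  assumes "x \<in> carrier L" "y \<in> carrier L" "z \<in> carrier L"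
  shows "br x (br y z) = br (br x y) z \<oplus>\<^bsub>L\<^esub> br y (br x z)"
proof -
  note c = assms bracket_closed
  have 1: "br y (br z x) = \<ominus>\<^bsub>L\<^esub> br y (br x z)"
    using bracket_skew[of x z] bracket_uminus_right[of y "br x z"] c by simp
  have 2: "br z (br x y) = \<ominus>\<^bsub>L\<^esub> br (br x y) z"
    using bracket_skew[of "br x y" z] c by simp
  have "br x (br y z) \<oplus>\<^bsub>L\<^esub> \<ominus>\<^bsub>L\<^esub> (br (br x y) z \<oplus>\<^bsub>L\<^esub> br y (br x z)) = \<zero>\<^bsub>L\<^esub>"
    using jacobi[OF assms] c unfolding 1 2 by (simp add: M.minus_add M.a_ac)
  then show ?thesis using c
    by (metis M.a_closed M.add.inv_closed M.minus_equality M.minus_minus)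
qed

text \<open>The adjoint action turns brackets into commutators. In this form
  \<open>[\<sigma> u, \<sigma> u']\<close> is seen to act on \<open>N\<close> as the commutator of
  \<open>S u\<close> and \<open>S u'\<close>.\<close>

lemma bracket_jacobi_left:
  assumes "x \<in> carrier L" "y \<in> carrier L" "z \<in> carrier L"
  shows "br (br x y) z = br x (br y z) \<ominus>\<^bsub>L\<^esub> br y (br x z)"
  unfolding jacobi_leibniz[OF assms] using assms bracket_closed
  by (simp add: a_minus_def M.a_assoc M.r_neg)

text \<open>
  Since \<open>\<gg>\<^sup>S\<close> is an image of the extension, this avoids checking the Jacobi identity for its
  bracket. The section \<open>\<tau>\<close> need not be linear; it makes \<open>M\<close> Hausdorff and its operations continuous.
\<close>

lemma topological_lie_algebra_surj_image:
  assumes lin: "linear_map K L M f" and surj: "f ` carrier L = carrier M"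
    and zero: "f \<zero>\<^bsub>L\<^esub> = \<zero>\<^bsub>M\<^esub>"
    and br: "\<And>x y. x \<in> carrier L \<Longrightarrow> y \<in> carrier L \<Longrightarrow> f (br x y) = \<^bold>[f x, f y\<^bold>]\<^bsub>M\<^esub>"
    and top: "topspace (vtop M) = carrier M" and cont: "continuous_map (vtop L) (vtop M) f"
    and sec: "continuous_map (vtop M) (vtop L) \<tau>" "\<And>m. m \<in> carrier M \<Longrightarrow> f (\<tau> m) = m"
  shows "topological_lie_algebra K M"
proof -
  \<comment> \<open>The homomorphism laws are oriented so that operations of \<open>M\<close> on
    images are pulled inside \<open>f\<close>. With \<open>Mo\<close> writing each element of
    \<open>M\<close> as an image, every algebraic axiom of \<open>M\<close> becomes \<open>f\<close>
    applied to an axiom of \<open>L\<close>.\<close>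
  note [simp] = linear_map_add[OF lin, symmetric] linear_map_smult[OF lin, symmetric]
    zero[symmetric] br[symmetric]
  note Mo = imageE[of _ f "carrier L", unfolded surj]
  have fc: "f x \<in> carrier M" if "x \<in> carrier L" for x using surj that by auto
  have \<tau>: "\<tau> m \<in> carrier L" if "m \<in> carrier M" for m
    using continuous_map_image_subset_topspace[OF sec(1)] that by (auto simp: topspace_vtop top)
  have grp: "abelian_group M"
  proof (rule abelian_groupI)
    fix x y assume "x \<in> carrier M" "y \<in> carrier M"
    then show "x \<oplus>\<^bsub>M\<^esub> y \<in> carrier M" "x \<oplus>\<^bsub>M\<^esub> y = y \<oplus>\<^bsub>M\<^esub> x"
      by (auto elim!: Mo intro!: fc simp: M.a_comm)
  next
    show "\<zero>\<^bsub>M\<^esub> \<in> carrier M" by (auto intro: fc)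
  next
    fix x y z assume "x \<in> carrier M" "y \<in> carrier M" "z \<in> carrier M"
    then show "x \<oplus>\<^bsub>M\<^esub> y \<oplus>\<^bsub>M\<^esub> z = x \<oplus>\<^bsub>M\<^esub> (y \<oplus>\<^bsub>M\<^esub> z)"
      by (auto elim!: Mo simp: M.a_assoc)
  next
    fix x assume "x \<in> carrier M"
    then obtain u where u: "u \<in> carrier L" "x = f u" by (rule Mo)
    then show "\<zero>\<^bsub>M\<^esub> \<oplus>\<^bsub>M\<^esub> x = x" by simp
    show "\<exists>y\<in>carrier M. y \<oplus>\<^bsub>M\<^esub> x = \<zero>\<^bsub>M\<^esub>"
      by (rule bexI[of _ "f (\<ominus>\<^bsub>L\<^esub> u)"]) (auto simp: u fc M.l_neg)
  qed
  have mod: "Module.module K M"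
    by (rule moduleI[OF _ grp])
      (auto elim!: Mo intro!: fc simp: smult_l_distr smult_r_distr smult_assoc1 cring_axioms)
  have ha: "Hausdorff_space (vtop M)"
  proof (rule Hausdorff_space_injective_preimage[OF Hausdorff_vtop sec(1)])
    show "inj_on \<tau> (topspace (vtop M))" using sec(2) top by (metis inj_onI)
  qed
  \<comment> \<open>An operation of \<open>M\<close> is computed by lifting its vector arguments
    with \<tau>, operating in \<open>L\<close> and applying \<open>f\<close>. Here \<open>X\<close>
    is either the topology of \<open>M\<close> or that of the field.\<close>
  have lift: "continuous_map (prod_topology X (vtop M)) (vtop M) h"
    if 1: "continuous_map (prod_topology X (vtop M)) (vtop L) h'"
      and 2: "\<And>a m. a \<in> topspace X \<Longrightarrow> m \<in> carrier M \<Longrightarrow> f (h' (a, m)) = h (a, m)"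
    for X :: "'z topology" and h h'
    by (rule continuous_map_eq[OF continuous_map_compose[OF 1 cont]]) (auto simp: 2 top)
  note \<tau>f = continuous_map_compose[OF continuous_map_fst sec(1), unfolded o_def]
  note \<tau>s = continuous_map_compose[OF continuous_map_snd sec(1), unfolded o_def]
  have cadd: "continuous_map (prod_topology (vtop M) (vtop M)) (vtop M) (\<lambda>(x, y). x \<oplus>\<^bsub>M\<^esub> y)"
    by (rule lift[OF continuous_map_vadd[OF \<tau>f \<tau>s]])
      (auto simp: linear_map_add[OF lin] \<tau> top sec(2) simp del: linear_map_add[OF lin, symmetric])
  have csm: "continuous_map (prod_topology (ring_top K) (vtop M)) (vtop M) (\<lambda>(a, x). a \<odot>\<^bsub>M\<^esub> x)"
    by (rule lift[OF continuous_map_smult[OF continuous_map_fst \<tau>s]])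
      (auto simp: linear_map_smult[OF lin] \<tau> topspace_ring sec(2) simp del: linear_map_smult[OF lin, symmetric])
  have cbr: "continuous_map (prod_topology (vtop M) (vtop M)) (vtop M) (\<lambda>(x, y). \<^bold>[x, y\<^bold>]\<^bsub>M\<^esub>)"
    by (rule lift[OF continuous_map_bracket[OF \<tau>f \<tau>s]])
      (auto simp: br \<tau> top sec(2) simp del: br[symmetric])
  have "topological_vector_space K M"
    by (intro topological_vector_space.intro topological_vector_space_axioms.intro
        topological_field_axioms mod top ha cadd csm)
  moreover have "topological_lie_algebra_axioms K M"
    by (rule topological_lie_algebra_axioms.intro)
      (auto elim!: Mo intro!: fc simp: bracket_closed bracket_add_left bracket_add_right
         bracket_smult_left bracket_smult_right bracket_self jacobi cbr)
  ultimately show ?thesis by (rule topological_lie_algebra.intro)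
qed

lemma topological_lie_algebra_restrict_to:
  assumes sub: "submodule W K L" and br: "\<And>x y. x \<in> W \<Longrightarrow> y \<in> W \<Longrightarrow> br x y \<in> W"
  shows "topological_lie_algebra K (restrict_to L W)"
proof -
  note W = submoduleE[OF sub]
  have z: "\<zero>\<^bsub>L\<^esub> \<in> W" 
    using additive_subgroup.zero_closed[OF submodule_additive_subgroup[OF sub]] .
  have WL: "x \<in> carrier L" if "x \<in> W" for x using W(1) that by auto
  have grp: "abelian_group (restrict_to L W)"
  proof (rule abelian_groupI)
    fix x assume "x \<in> carrier (restrict_to L W)"
    then show "\<exists>y\<in>carrier (restrict_to L W). y \<oplus>\<^bsub>restrict_to L W\<^esub> x = \<zero>\<^bsub>restrict_to L W\<^esub>"
      using W(3) by (intro bexI[of _ "\<ominus>\<^bsub>L\<^esub> x"]) (auto simp: restrict_to_def WL M.l_neg)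
  qed (auto simp: restrict_to_def W(5) z WL M.a_ac)
  have mod: "Module.module K (restrict_to L W)"
    by (rule moduleI[OF _ grp]) (auto simp: restrict_to_def WL W(4) smult_l_distr smult_r_distr smult_assoc1 cring_axioms)
  have top: "topspace (vtop (restrict_to L W)) = carrier (restrict_to L W)"
    using W(1) by (auto simp: restrict_to_def topspace_vtop)
  have Wc: "continuous_map (subtopology (vtop L) W) (vtop L) (\<lambda>x. x)"
    using continuous_map_id_subt[of "vtop L" W] by (simp add: id_def)
  note f = continuous_map_compose[OF continuous_map_fst Wc, unfolded o_def]
  note s = continuous_map_compose[OF continuous_map_snd Wc, unfolded o_def]
  have c1: "continuous_map (prod_topology (vtop (restrict_to L W)) (vtop (restrict_to L W))) (vtop (restrict_to L W)) (\<lambda>(x, y). x \<oplus>\<^bsub>restrict_to L W\<^esub> y)"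
    using W(5) by (auto simp: restrict_to_def case_prod_unfold topspace_vtop
        intro!: continuous_map_into_subtopology continuous_map_vadd f s)
  have c2: "continuous_map (prod_topology (ring_top K) (vtop (restrict_to L W))) (vtop (restrict_to L W)) (\<lambda>(x, y). x \<odot>\<^bsub>restrict_to L W\<^esub> y)"
    using W(4) by (auto simp: restrict_to_def case_prod_unfold topspace_vtop topspace_ring
        intro!: continuous_map_into_subtopology continuous_map_smult continuous_map_fst s)
  have c3: "continuous_map (prod_topology (vtop (restrict_to L W)) (vtop (restrict_to L W))) (vtop (restrict_to L W)) (\<lambda>(x, y). \<^bold>[x, y\<^bold>]\<^bsub>restrict_to L W\<^esub>)"
    using br by (auto simp: restrict_to_def case_prod_unfold topspace_vtop
        intro!: continuous_map_into_subtopology continuous_map_bracket f s)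
  have ha: "Hausdorff_space (vtop (restrict_to L W))"
    by (simp add: restrict_to_def Hausdorff_vtop Hausdorff_space_subtopology)
  have "topological_vector_space K (restrict_to L W)"
    by (intro topological_vector_space.intro topological_vector_space_axioms.intro
        topological_field_axioms mod top ha c1 c2)
  moreover have "topological_lie_algebra_axioms K (restrict_to L W)"
    by (rule topological_lie_algebra_axioms.intro[OF _ _ _ _ _ _ _ c3])
      (auto simp: restrict_to_def WL br bracket_add_left bracket_add_right
         bracket_smult_left bracket_smult_right bracket_self jacobi)
  ultimately show ?thesis by (rule topological_lie_algebra.intro)
qed

lemma in_center_iff: "z \<in> carrier L \<Longrightarrow> z \<in> center L \<longleftrightarrow> (\<forall>x\<in>carrier L. br z x = \<zero>\<^bsub>L\<^esub>)"
  by (simp add: center_def)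

lemma bracket_center_right: "z \<in> center L \<Longrightarrow> x \<in> carrier L \<Longrightarrow> br x z = \<zero>\<^bsub>L\<^esub>"
  using bracket_skew[of z x] by (simp add: center_def)

end

section \<open>Extensions\<close>

text \<open>Both maps come from one projection \<open>P\<close> of \<open>H\<close> onto the image
  of \<open>N\<close>: the retraction is \<open>P\<close> followed by the inverse of the embedding,
  and the section is induced by id - P, which vanishes on the kernel of \<open>q\<close>.\<close>

lemma is_extensionD:
  assumes "is_extension K G N (H, \<iota>, q)"
  shows "\<exists>r \<sigma>. continuous_linear_map K H N r \<and> (\<forall>n\<in>carrier N. r (\<iota> n) = n) \<and>
    continuous_linear_map K G H \<sigma> \<and> (\<forall>x\<in>carrier G. q (\<sigma> x) = x)"
proof -
  have *: "topological_lie_algebra K G" "topological_lie_algebra K N" "topological_lie_algebra K H"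
    "lie_hom K N H \<iota>" "embedding_map (vtop N) (vtop H) \<iota>" "topologically_split K H (\<iota> ` carrier N)"
    "lie_hom K H G q" "quotient_map (vtop H) (vtop G) q"
    "{x \<in> carrier H. q x = \<zero>\<^bsub>G\<^esub>} = \<iota> ` carrier N"
    using assms by (auto simp: is_extension_def)
  interpret G: topological_lie_algebra K G by fact
  interpret N: topological_lie_algebra K N by fact
  interpret H: topological_lie_algebra K H by fact
  have \<iota>: "linear_map K N H \<iota>" and q: "linear_map K H G q" using * by (auto simp: lie_hom_def)
  obtain P where "continuous_linear_projection K H (\<iota> ` carrier N) P"
    using * H.projection_of_topologically_split by (metis topologically_split_def)
  then have P: "linear_map K H H P" "continuous_map (vtop H) (vtop H) P" 
    "\<And>x. x \<in> carrier H \<Longrightarrow> P x \<in> \<iota> ` carrier N" "\<And>n. n \<in> carrier N \<Longrightarrow> P (\<iota> n) = \<iota> n"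
    by (auto simp: continuous_linear_projection_def continuous_linear_map_def)
  obtain j where j: "homeomorphic_maps (vtop N) (subtopology (vtop H) (\<iota> ` carrier N)) \<iota> j"
    using *(5) by (auto simp: embedding_map_def homeomorphic_map_maps N.topspace_vtop)
  have \<iota>c: "\<iota> n \<in> carrier H" if "n \<in> carrier N" for n using linear_map_closed[OF \<iota> that] .
  have jc: "continuous_map (subtopology (vtop H) (\<iota> ` carrier N)) (vtop N) j"
    and j\<iota>: "\<And>n. n \<in> carrier N \<Longrightarrow> j (\<iota> n) = n"
    using j by (auto simp: homeomorphic_maps_def N.topspace_vtop)
  define r where "r x = j (P x)" for x
  have \<iota>r: "\<iota> (r x) = P x" and rc: "r x \<in> carrier N" if "x \<in> carrier H" for x
    using P(3)[OF that] j\<iota> by (auto simp: r_def)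
  have inj: "inj_on \<iota> (carrier N)" using j\<iota> by (metis inj_onI)
  have "r (x \<oplus>\<^bsub>H\<^esub> y) = r x \<oplus>\<^bsub>N\<^esub> r y" if "x \<in> carrier H" "y \<in> carrier H" for x y
    by (rule inj_onD[OF inj])
      (use that in \<open>auto simp: \<iota>r rc linear_map_add[OF \<iota>] linear_map_add[OF P(1)]\<close>)
  moreover have "r (a \<odot>\<^bsub>H\<^esub> x) = a \<odot>\<^bsub>N\<^esub> r x" if "a \<in> carrier K" "x \<in> carrier H" for x a
    by (rule inj_onD[OF inj])
      (use that in \<open>auto simp: \<iota>r rc linear_map_smult[OF \<iota>] linear_map_smult[OF P(1)]\<close>)
  ultimately have "linear_map K H N r" by (auto simp: linear_map_def rc)
  moreover have "continuous_map (vtop H) (vtop N) r"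
    unfolding r_def
    by (rule continuous_map_compose[OF _ jc, unfolded o_def])
      (auto intro!: continuous_map_into_subtopology P simp: H.topspace_vtop)
  ultimately have r: "continuous_linear_map K H N r" by (simp add: continuous_linear_map_def)
  have r\<iota>: "r (\<iota> n) = n" if "n \<in> carrier N" for n using that by (simp add: r_def P(4) j\<iota>)
  \<comment> \<open>The choice of a preimage of \<open>u\<close> is harmless: two preimages differ
    by some \<open>\<iota> n\<close>, and \<open>P\<close> fixes \<open>\<iota> n\<close>.\<close>
  define \<sigma> where "\<sigma> u = (let x = SOME x. x \<in> carrier H \<and> q x = u in x \<ominus>\<^bsub>H\<^esub> P x)" for u
  have q\<iota>: "q (\<iota> n) = \<zero>\<^bsub>G\<^esub>" if "n \<in> carrier N" for n using that *(9) by auto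
  have \<sigma>q: "\<sigma> (q x) = x \<ominus>\<^bsub>H\<^esub> P x" if x: "x \<in> carrier H" for x
  proof -
    define y where "y = (SOME y. y \<in> carrier H \<and> q y = q x)"
    have y: "y \<in> carrier H" "q y = q x"
      unfolding y_def using someI[of "\<lambda>y. y \<in> carrier H \<and> q y = q x" x] x by auto
    have "q (x \<ominus>\<^bsub>H\<^esub> y) = \<zero>\<^bsub>G\<^esub>"
      using x y linear_map_closed[OF q x]
      by (subst linear_map_minus[OF H.is_module G.is_module q])
        (auto simp: a_minus_def G.M.r_neg)
    then have "x \<ominus>\<^bsub>H\<^esub> y \<in> \<iota> ` carrier N" using *(9) x y by auto
    then obtain n where n: "n \<in> carrier N" "x \<ominus>\<^bsub>H\<^esub> y = \<iota> n" by auto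
    have xeq: "x = \<iota> n \<oplus>\<^bsub>H\<^esub> y"
      using x y n(2)[symmetric] by (simp add: a_minus_def H.M.a_assoc H.M.l_neg)
    have "x \<ominus>\<^bsub>H\<^esub> P x = y \<ominus>\<^bsub>H\<^esub> P y"
      unfolding xeq using n y \<iota>c linear_map_closed[OF P(1)]
      by (simp add: linear_map_add[OF P(1)] P(4) a_minus_def H.M.minus_add H.M.a_ac H.M.r_neg_middle H.M.r_neg_last)
    then show ?thesis by (simp add: \<sigma>_def y_def Let_def)
  qed
  have qo: "\<And>u P. u \<in> carrier G \<Longrightarrow> (\<And>x. x \<in> carrier H \<Longrightarrow> u = q x \<Longrightarrow> P) \<Longrightarrow> P"
    using quotient_imp_surjective_map[OF *(8)] by (auto simp: H.topspace_vtop G.topspace_vtop)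
  have Q: "continuous_linear_map K H H (\<lambda>x. x \<ominus>\<^bsub>H\<^esub> P x)"
    by (intro H.continuous_linear_map_vminus H.continuous_linear_map_id)
      (simp add: P continuous_linear_map_def)
  have "linear_map K G H \<sigma>"
    using Q unfolding linear_map_def continuous_linear_map_def
    by (auto elim!: qo simp: \<sigma>q simp flip: linear_map_add[OF q] linear_map_smult[OF q])
  \<comment> \<open>Since \<open>q\<close> is a quotient map, continuity may be tested after
    composing with \<open>q\<close>, where the map is id - P.\<close>
  moreover have "continuous_map (vtop G) (vtop H) \<sigma>"
  proof (rule continuous_compose_quotient_map[OF *(8)])
    show "continuous_map (vtop H) (vtop H) (\<sigma> \<circ> q)"
      by (rule continuous_map_eq[of _ _ "\<lambda>x. x \<ominus>\<^bsub>H\<^esub> P x"])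
        (use Q in \<open>auto simp: continuous_linear_map_def \<sigma>q H.topspace_vtop\<close>)
  qed
  moreover have "q (\<sigma> u) = u" if "u \<in> carrier G" for u
  proof -
    obtain x where x: "x \<in> carrier H" "u = q x" by (rule qo[OF \<open>u \<in> carrier G\<close>])
    have "q (P x) = \<zero>\<^bsub>G\<^esub>" using P(3)[OF x(1)] q\<iota> by auto
    then show ?thesis using x linear_map_closed[OF P(1)] linear_map_closed[OF q]
      unfolding x(2) \<sigma>q[OF x(1)]
      by (subst linear_map_minus[OF H.is_module G.is_module q]) (auto simp: a_minus_def)
  qed
  ultimately show ?thesis using r r\<iota>
    unfolding continuous_linear_map_def by blast
qed

text \<open>The retraction \<open>r\<close> makes \<iota> an embedding and
  \<open>\<iota> \<circ> r\<close> a projection onto its image, while the section makes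
  \<open>q\<close> a quotient map. Only continuity is asked of \<sigma>, because the section of
  \<gamma> constructed later rests on a section of \<open>ad\<close> that is known only to be
  continuous.\<close>

lemma is_extensionI:
  assumes "topological_lie_algebra K G" "topological_lie_algebra K N" "topological_lie_algebra K H"
    and \<iota>: "lie_hom K N H \<iota>" "continuous_map (vtop N) (vtop H) \<iota>"
    and q: "lie_hom K H G q" "continuous_map (vtop H) (vtop G) q"
    and r: "continuous_linear_map K H N r" "\<And>n. n \<in> carrier N \<Longrightarrow> r (\<iota> n) = n"
    and \<sigma>: "continuous_map (vtop G) (vtop H) \<sigma>" "\<And>x. x \<in> carrier G \<Longrightarrow> q (\<sigma> x) = x"
    and ker: "{x \<in> carrier H. q x = \<zero>\<^bsub>G\<^esub>} = \<iota> ` carrier N"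
  shows "is_extension K G N (H, \<iota>, q)"
proof -
  interpret G: topological_lie_algebra K G by fact
  interpret N: topological_lie_algebra K N by fact
  interpret H: topological_lie_algebra K H by fact
  have \<iota>l: "linear_map K N H \<iota>" and ql: "linear_map K H G q" using \<iota> q by (auto simp: lie_hom_def)
  have rl: "linear_map K H N r" and rc: "continuous_map (vtop H) (vtop N) r"
    using r by (auto simp: continuous_linear_map_def)
  have "section_map (vtop N) (vtop H) \<iota>"
    unfolding section_map_def retraction_maps_def using \<iota> rc r(2) by (auto simp: N.topspace_vtop)
  then have "embedding_map (vtop N) (vtop H) \<iota>" by (rule section_imp_embedding_map)
  moreover have sub: "submodule (\<iota> ` carrier N) K H"
    using submodule_kernel[OF H.is_module G.is_module ql] by (simp add: ker)
  moreover have "\<^bold>[x, y\<^bold>]\<^bsub>H\<^esub> \<in> \<iota> ` carrier N" if "x \<in> carrier H" "y \<in> \<iota> ` carrier N" for x y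
  proof -
    have "y \<in> carrier H" "q y = \<zero>\<^bsub>G\<^esub>" using that(2) ker by auto
    then have "q \<^bold>[x, y\<^bold>]\<^bsub>H\<^esub> = \<zero>\<^bsub>G\<^esub>"
      using q(1) that(1) linear_map_closed[OF ql] by (simp add: lie_hom_def G.bracket_zero_right)
    then show ?thesis using ker H.bracket_closed that(1) \<open>y \<in> carrier H\<close> by blast
  qed
  moreover have "topologically_split K H (\<iota> ` carrier N)"
  proof (rule H.topologically_split_of_projection[OF sub])
    show "continuous_linear_projection K H (\<iota> ` carrier N) (\<lambda>x. \<iota> (r x))"
      unfolding continuous_linear_projection_def
      using continuous_linear_map_comp[OF r(1), of H \<iota>] \<iota>(2) \<iota>l r(2) linear_map_closed[OF rl]
      by (auto simp: continuous_linear_map_def)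
  qed
  moreover have "quotient_map (vtop H) (vtop G) q"
    by (rule retraction_imp_quotient_map)
      (use q \<sigma> in \<open>auto simp: retraction_map_def retraction_maps_def G.topspace_vtop\<close>)
  ultimately show ?thesis
    using assms by (auto simp: is_extension_def lie_ideal_def)
qed

text \<open>An arbitrary retraction is unrelated to the given \<sigma>. First subtracting
  \<open>\<sigma> (q x)\<close>, which lands in the kernel of \<open>q\<close>, yields one that
  complements \<sigma>.\<close>

lemma retraction_of_section:
  assumes "is_extension K G N (H, \<iota>, q)"
    and \<sigma>: "continuous_linear_map K G H \<sigma>" "\<And>x. x \<in> carrier G \<Longrightarrow> q (\<sigma> x) = x"
  shows "\<exists>r. continuous_linear_map K H N r \<and> (\<forall>n\<in>carrier N. r (\<iota> n) = n) \<and>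
    (\<forall>x\<in>carrier H. x = \<iota> (r x) \<oplus>\<^bsub>H\<^esub> \<sigma> (q x))"
proof -
  have *: "topological_lie_algebra K G" "topological_lie_algebra K N" "topological_lie_algebra K H"
    "lie_hom K N H \<iota>" "lie_hom K H G q" "quotient_map (vtop H) (vtop G) q"
    "{x \<in> carrier H. q x = \<zero>\<^bsub>G\<^esub>} = \<iota> ` carrier N"
    using assms(1) by (auto simp: is_extension_def)
  interpret G: topological_lie_algebra K G by fact
  interpret N: topological_lie_algebra K N by fact
  interpret H: topological_lie_algebra K H by fact
  obtain r where r: "continuous_linear_map K H N r" "\<And>n. n \<in> carrier N \<Longrightarrow> r (\<iota> n) = n"
    using is_extensionD[OF assms(1)] by blast
  have \<iota>: "linear_map K N H \<iota>" and q: "linear_map K H G q" using * by (auto simp: lie_hom_def)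
  have \<sigma>l: "linear_map K G H \<sigma>" using \<sigma> by (simp add: continuous_linear_map_def)
  define p where "p x = x \<ominus>\<^bsub>H\<^esub> \<sigma> (q x)" for x
  have p: "continuous_linear_map K H H p" unfolding p_def
    by (intro H.continuous_linear_map_vminus H.continuous_linear_map_id continuous_linear_map_comp[OF _ \<sigma>(1)])
      (use q quotient_imp_continuous_map[OF *(6)] in \<open>auto simp: continuous_linear_map_def\<close>)
  have pc: "p x \<in> carrier H" if "x \<in> carrier H" for x
    using p that by (auto simp: continuous_linear_map_def linear_map_closed)
  have p_in: "p x \<in> \<iota> ` carrier N" if x: "x \<in> carrier H" for x
  proof -
    have "q (p x) = \<zero>\<^bsub>G\<^esub>" unfolding p_def
      using x linear_map_closed[OF \<sigma>l] linear_map_closed[OF q] 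
      by (subst linear_map_minus[OF H.is_module G.is_module q])
        (auto simp: \<sigma>(2) a_minus_def G.M.r_neg)
    then show ?thesis using pc[OF x] *(7) by auto
  qed
  have "x = \<iota> (r (p x)) \<oplus>\<^bsub>H\<^esub> \<sigma> (q x)" if x: "x \<in> carrier H" for x
  proof -
    have "\<iota> (r (p x)) = p x" using p_in[OF x] r(2) by auto
    then show ?thesis using x linear_map_closed[OF \<sigma>l] linear_map_closed[OF q]
      by (simp add: p_def H.M.a_comm[of "x \<ominus>\<^bsub>H\<^esub> _"] H.vminus_add_cancel)
  qed
  moreover have "r (p (\<iota> n)) = n" if n: "n \<in> carrier N" for n
  proof -
    have "q (\<iota> n) = \<zero>\<^bsub>G\<^esub>" using n *(7) by auto
    then show ?thesis using n linear_map_closed[OF \<iota>] r(2)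
      by (simp add: p_def linear_map_zero[OF G.is_module H.is_module \<sigma>l] a_minus_def)
  qed
  ultimately show ?thesis
    using continuous_linear_map_comp[OF p r(1)] by blast
qed

section \<open>Derivations\<close>

lemma ad_apply: "n \<in> carrier L \<Longrightarrow> ad L x n = \<^bold>[x, n\<^bold>]\<^bsub>L\<^esub>"
  by (simp add: ad_def)

lemma ad_extensional: "ad L x \<in> extensional (carrier L)"
  by (simp add: ad_def)

lemma ad_eq_iff: "ad L x = ad L y \<longleftrightarrow> (\<forall>z\<in>carrier L. \<^bold>[x, z\<^bold>]\<^bsub>L\<^esub> = \<^bold>[y, z\<^bold>]\<^bsub>L\<^esub>)"
proof
  assume "ad L x = ad L y"
  then show "\<forall>z\<in>carrier L. \<^bold>[x, z\<^bold>]\<^bsub>L\<^esub> = \<^bold>[y, z\<^bold>]\<^bsub>L\<^esub>" by (metis ad_apply)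
next
  assume "\<forall>z\<in>carrier L. \<^bold>[x, z\<^bold>]\<^bsub>L\<^esub> = \<^bold>[y, z\<^bold>]\<^bsub>L\<^esub>"
  then show "ad L x = ad L y" by (auto simp: ad_def)
qed

lemma der_carrierD:
  assumes "D \<in> carrier (der K L)"
  shows "D \<in> extensional (carrier L)" "continuous_linear_map K L L D" "linear_map K L L D"
    "x \<in> carrier L \<Longrightarrow> D x \<in> carrier L"
    "x \<in> carrier L \<Longrightarrow> y \<in> carrier L \<Longrightarrow> D \<^bold>[x, y\<^bold>]\<^bsub>L\<^esub> = \<^bold>[D x, y\<^bold>]\<^bsub>L\<^esub> \<oplus>\<^bsub>L\<^esub> \<^bold>[x, D y\<^bold>]\<^bsub>L\<^esub>"
proof -
  have *: "D \<in> extensional (carrier L)" "continuous_linear_map K L L D"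
    "\<forall>x\<in>carrier L. \<forall>y\<in>carrier L. D \<^bold>[x, y\<^bold>]\<^bsub>L\<^esub> = \<^bold>[D x, y\<^bold>]\<^bsub>L\<^esub> \<oplus>\<^bsub>L\<^esub> \<^bold>[x, D y\<^bold>]\<^bsub>L\<^esub>"
    using assms by (simp_all add: der_def)
  then show "D \<in> extensional (carrier L)" "continuous_linear_map K L L D" "linear_map K L L D"
    by (simp_all add: continuous_linear_map_def)
  then show "x \<in> carrier L \<Longrightarrow> D x \<in> carrier L"
    by (simp add: linear_map_closed)
  show "x \<in> carrier L \<Longrightarrow> y \<in> carrier L \<Longrightarrow> D \<^bold>[x, y\<^bold>]\<^bsub>L\<^esub> = \<^bold>[D x, y\<^bold>]\<^bsub>L\<^esub> \<oplus>\<^bsub>L\<^esub> \<^bold>[x, D y\<^bold>]\<^bsub>L\<^esub>"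
    using * by blast
qed

lemma der_add: "D \<oplus>\<^bsub>der K L\<^esub> E = (\<lambda>x\<in>carrier L. D x \<oplus>\<^bsub>L\<^esub> E x)"
  and der_zero: "\<zero>\<^bsub>der K L\<^esub> = (\<lambda>x\<in>carrier L. \<zero>\<^bsub>L\<^esub>)"
  and der_smult: "a \<odot>\<^bsub>der K L\<^esub> D = (\<lambda>x\<in>carrier L. a \<odot>\<^bsub>L\<^esub> D x)"
  and der_bracket: "\<^bold>[D, E\<^bold>]\<^bsub>der K L\<^esub> = (\<lambda>x\<in>carrier L. D (E x) \<ominus>\<^bsub>L\<^esub> E (D x))"
  by (simp_all add: der_def)

context topological_lie_algebra
begin

lemma continuous_linear_map_cong:
  assumes f: "continuous_linear_map K L W f" and eq: "\<And>x. x \<in> carrier L \<Longrightarrow> f x = g x"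
  shows "continuous_linear_map K L W g"
proof -
  have "linear_map K L W g"
    using f by (auto simp: continuous_linear_map_def linear_map_def eq[symmetric])
  moreover have "continuous_map (vtop L) (vtop W) g"
    using f eq by (auto simp: continuous_linear_map_def topspace_vtop intro: continuous_map_eq[of _ _ f])
  ultimately show ?thesis by (simp add: continuous_linear_map_def)
qed

text \<open>Negation in \<open>der K L\<close> is a definite description over the carrier, and
  \<open>der K L\<close> has not been made a group here. Its value is found by checking that the
  pointwise negative is a derivation and that an additive inverse is unique.\<close>

lemma der_uminus:
  assumes D: "D \<in> carrier (der K L)"
  shows "\<ominus>\<^bsub>der K L\<^esub> D = (\<lambda>x\<in>carrier L. \<ominus>\<^bsub>L\<^esub> D x)"
proof -
  note d = der_carrierD[OF D]
  let ?E = "\<lambda>x\<in>carrier L. \<ominus>\<^bsub>L\<^esub> D x"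
  have E: "?E \<in> carrier (der K L)"
  proof -
    have "continuous_linear_map K L L (\<lambda>x. \<zero>\<^bsub>L\<^esub> \<ominus>\<^bsub>L\<^esub> D x)"
      by (intro continuous_linear_map_vminus continuous_linear_map_zero_map d(2))
    then have "continuous_linear_map K L L ?E"
      by (rule continuous_linear_map_cong) (use d(4) in \<open>simp add: a_minus_def\<close>)
    then show ?thesis
      by (simp add: der_def bracket_closed d(4,5) M.minus_add bracket_uminus_left bracket_uminus_right)
  qed
  have uniq: "F = ?E" if F: "F \<in> carrier (der K L)" "D \<oplus>\<^bsub>der K L\<^esub> F = \<zero>\<^bsub>der K L\<^esub>" for F
  proof (rule extensionalityI[of _ "carrier L"])
    fix x assume x: "x \<in> carrier L"
    have "D x \<oplus>\<^bsub>L\<^esub> F x = \<zero>\<^bsub>L\<^esub>"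
      using fun_cong[OF F(2), of x] x by (simp add: der_add der_zero)
    then have "F x \<oplus>\<^bsub>L\<^esub> D x = \<zero>\<^bsub>L\<^esub>"
      using d(4)[OF x] der_carrierD(4)[OF F(1) x] M.a_comm by metis
    then have "\<ominus>\<^bsub>L\<^esub> D x = F x"
      using d(4)[OF x] der_carrierD(4)[OF F(1) x] by (rule M.minus_equality)
    then show "F x = ?E x" using x by simp
  qed (simp_all add: der_carrierD(1)[OF F(1)])
  have inv: "D \<oplus>\<^bsub>der K L\<^esub> ?E = \<zero>\<^bsub>der K L\<^esub>" "?E \<oplus>\<^bsub>der K L\<^esub> D = \<zero>\<^bsub>der K L\<^esub>"
    by (auto simp: d(4) der_add der_zero M.r_neg M.l_neg intro!: restrict_ext)
  show ?thesis
    unfolding a_inv_def[of "der K L"] m_inv_def[of "add_monoid (der K L)"]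
    by (rule the_equality) (simp add: E inv, rule uniq, simp_all)
qed

lemma der_minus:
  assumes "E \<in> carrier (der K L)"
  shows "D \<ominus>\<^bsub>der K L\<^esub> E = (\<lambda>x\<in>carrier L. D x \<ominus>\<^bsub>L\<^esub> E x)"
  using assms by (auto simp: a_minus_def[of "der K L"] der_uminus der_add a_minus_def[of L] intro!: restrict_ext)

lemma ad_add: "x \<in> carrier L \<Longrightarrow> y \<in> carrier L \<Longrightarrow> ad L (x \<oplus>\<^bsub>L\<^esub> y) = ad L x \<oplus>\<^bsub>der K L\<^esub> ad L y"
  by (auto simp: ad_def der_add bracket_add_left intro!: restrict_ext)

lemma ad_smult: "a \<in> carrier K \<Longrightarrow> x \<in> carrier L \<Longrightarrow> ad L (a \<odot>\<^bsub>L\<^esub> x) = a \<odot>\<^bsub>der K L\<^esub> ad L x"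
  by (auto simp: ad_def der_smult bracket_smult_left intro!: restrict_ext)

lemma ad_zero: "ad L \<zero>\<^bsub>L\<^esub> = \<zero>\<^bsub>der K L\<^esub>"
  by (auto simp: ad_def der_zero bracket_zero_left intro!: restrict_ext)

lemma ad_eq_zero_iff: "x \<in> carrier L \<Longrightarrow> ad L x = \<zero>\<^bsub>der K L\<^esub> \<longleftrightarrow> x \<in> center L"
  by (simp add: in_center_iff ad_eq_iff bracket_zero_left flip: ad_zero)

text \<open>The Leibniz rule solved for its first term: \<open>ad (D x)\<close> depends on
  \<open>x\<close> only through \<open>ad x\<close>. Hence derivations preserve the centre, and the
  mixed terms in the bracket of \<gg>\<open>\<^sup>S\<close> do not depend on
  representatives.\<close>

lemma derivation_ad:
  assumes "D \<in> carrier (der K L)" "x \<in> carrier L" "y \<in> carrier L"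
  shows "br (D x) y = D (br x y) \<ominus>\<^bsub>L\<^esub> br x (D y)"
  using assms der_carrierD[OF assms(1)] bracket_closed by (simp add: a_minus_def M.a_assoc M.r_neg)

lemma derivation_center:
  assumes "D \<in> carrier (der K L)" "z \<in> center L"
  shows "D z \<in> center L"
proof -
  note d = der_carrierD[OF assms(1)]
  have z: "z \<in> carrier L" "\<And>x. x \<in> carrier L \<Longrightarrow> br z x = \<zero>\<^bsub>L\<^esub>" 
    using assms(2) by (auto simp: center_def)
  then show ?thesis
    using d(4) linear_map_zero[OF is_module is_module d(3)] 
    by (simp add: in_center_iff derivation_ad[OF assms(1)] a_minus_def)
qed

text \<open>Subtracting from \<open>n\<close> its component in the centre removes the ambiguity of
  \<open>n\<close> given \<open>ad n\<close>. The resulting function of \<open>ad n\<close> is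
  continuous because the topology on the image is the quotient topology.\<close>

lemma continuous_section_ad:
  assumes "topologically_split K L (center L)"
  shows "\<exists>s. continuous_map (quotient_topology (vtop L) (ad L)) (vtop L) s \<and>
    (\<forall>n\<in>carrier L. ad L (s (ad L n)) = ad L n)"
proof -
  have sub: "submodule (center L) K L" using assms by (simp add: topologically_split_def)
  obtain P where "continuous_linear_projection K L (center L) P"
    using projection_of_topologically_split[OF sub assms] by blast
  then have P: "linear_map K L L P" "continuous_map (vtop L) (vtop L) P"
    "\<And>x. x \<in> carrier L \<Longrightarrow> P x \<in> center L" "\<And>n. n \<in> center L \<Longrightarrow> P n = n"
    by (auto simp: continuous_linear_projection_def continuous_linear_map_def)
  note Pc = linear_map_closed[OF P(1)]
  define s where "s D = (let n = SOME n. n \<in> carrier L \<and> D = ad L n in n \<ominus>\<^bsub>L\<^esub> P n)" for D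
  have s: "s (ad L n) = n \<ominus>\<^bsub>L\<^esub> P n" if n: "n \<in> carrier L" for n
  proof -
    define m where "m = (SOME m. m \<in> carrier L \<and> ad L n = ad L m)"
    have m: "m \<in> carrier L" "ad L n = ad L m"
      unfolding m_def using someI[of "\<lambda>m. m \<in> carrier L \<and> ad L n = ad L m" n] n by auto
    define z where "z = n \<ominus>\<^bsub>L\<^esub> m"
    have zc: "z \<in> carrier L" using n m by (simp add: z_def)
    have z: "z \<in> center L"
    proof -
      have "br z x = \<zero>\<^bsub>L\<^esub>" if x: "x \<in> carrier L" for x
      proof -
        have "br n x = br m x" using m(2) x by (simp add: ad_eq_iff)
        then show ?thesis
          using n m(1) x unfolding z_def
          by (simp only: bracket_minus_left) (simp add: a_minus_def bracket_closed M.r_neg)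
      qed
      then show ?thesis using zc by (simp add: in_center_iff)
    qed
    have neq: "n = z \<oplus>\<^bsub>L\<^esub> m"
      using n m by (simp add: z_def a_minus_def M.a_assoc M.l_neg)
    have "n \<ominus>\<^bsub>L\<^esub> P n = m \<ominus>\<^bsub>L\<^esub> P m"
      unfolding neq using zc m(1) Pc
      by (simp add: linear_map_add[OF P(1)] P(4)[OF z] a_minus_def M.minus_add M.a_ac M.r_neg_middle M.r_neg_last
          M.r_neg1 M.r_neg2)
    then show ?thesis by (simp add: s_def m_def Let_def)
  qed
  have "continuous_map (quotient_topology (vtop L) (ad L)) (vtop L) s"
  proof (rule continuous_compose_quotient_map[OF quotient_map_quotient_topology])
    have "continuous_map (vtop L) (vtop L) (\<lambda>n. n \<ominus>\<^bsub>L\<^esub> P n)"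
      by (intro continuous_map_vminus P) auto
    then show "continuous_map (vtop L) (vtop L) (s \<circ> ad L)"
      by (rule continuous_map_eq) (simp add: s topspace_vtop)
  qed
  moreover have "ad L (s (ad L n)) = ad L n" if n: "n \<in> carrier L" for n
    using P(3)[OF n] n Pc[OF n]
    by (simp add: s ad_eq_iff bracket_minus_left) (simp add: center_def a_minus_def bracket_closed)
  ultimately show ?thesis by blast
qed

end

section \<open>Outer actions\<close>

locale outer_action =
  G: topological_lie_algebra K G + N: topological_lie_algebra K N
  for K :: "'k top_ring" and G :: "('k, 'g) top_module" and N :: "('k, 'n) top_module" +
  fixes S :: "'g \<Rightarrow> 'n \<Rightarrow> 'n"
  assumes outer: "continuous_outer_action K G N S"
begin

lemma S_linear: "linear_map K G (der K N) S"
  using outer by (simp add: continuous_outer_action_def)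

lemma S_der: "x \<in> carrier G \<Longrightarrow> S x \<in> carrier (der K N)"
  by (rule linear_map_closed[OF S_linear])

lemma S_closed: "x \<in> carrier G \<Longrightarrow> n \<in> carrier N \<Longrightarrow> S x n \<in> carrier N"
  using S_der der_carrierD(4) by metis

lemma S_extensional: "x \<in> carrier G \<Longrightarrow> S x \<in> extensional (carrier N)"
  using S_der der_carrierD(1) by metis

lemma curvature_cochain_closed:
  assumes "\<omega> \<in> curvature_cochains K G N S" "x \<in> carrier G" "y \<in> carrier G"
  shows "\<omega> x y \<in> carrier N"
  using assms by (auto simp: curvature_cochains_def cochains2_def intro: linear_map_closed)

text \<open>The right-hand side is free of \<omega>, so all admissible cochains have the same image
  under \<open>ad\<close>.\<close>

lemma bracket_curvature_cochain:
  assumes \<omega>: "\<omega> \<in> curvature_cochains K G N S" and xy: "x \<in> carrier G" "y \<in> carrier G"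
    and m: "m \<in> carrier N"
  shows "N.br (\<omega> x y) m = S x (S y m) \<ominus>\<^bsub>N\<^esub> S y (S x m) \<ominus>\<^bsub>N\<^esub> S (G.br x y) m"
proof -
  have "ad N (\<omega> x y) m = curvature K G N S x y m"
    using \<omega> xy by (simp add: curvature_cochains_def)
  then show ?thesis
    using m xy by (simp add: ad_apply curvature_def N.der_minus S_der G.bracket_closed der_bracket)
qed

text \<open>Evaluates the definite description at any chosen representatives. Uniqueness is tested
  by bracketing with \<open>m\<close>: each of the four summands then depends only on
  \<open>ad n\<close>, \<open>ad n'\<close> and the curvature.\<close>

lemma gS_bracket_ad:
  assumes n: "n \<in> carrier N" "n' \<in> carrier N" and x: "x \<in> carrier G" "x' \<in> carrier G"
    and \<omega>: "\<omega> \<in> curvature_cochains K G N S"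
  shows "gS_bracket K G N S (ad N n, x) (ad N n', x') =
    (ad N (N.br n n' \<oplus>\<^bsub>N\<^esub> S x n' \<ominus>\<^bsub>N\<^esub> S x' n \<oplus>\<^bsub>N\<^esub> \<omega> x x'), G.br x x')"
proof -
  let ?B = "\<lambda>n n' \<omega>. N.br n n' \<oplus>\<^bsub>N\<^esub> S x n' \<ominus>\<^bsub>N\<^esub> S x' n \<oplus>\<^bsub>N\<^esub> \<omega> x x'"
  have B: "N.br (?B n n' \<omega>) m = N.br (N.br n n') m \<oplus>\<^bsub>N\<^esub> N.br (S x n') m
      \<ominus>\<^bsub>N\<^esub> N.br (S x' n) m \<oplus>\<^bsub>N\<^esub> N.br (\<omega> x x') m"
    if "n \<in> carrier N" "n' \<in> carrier N" "m \<in> carrier N" "\<omega> \<in> curvature_cochains K G N S" for n n' m \<omega>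
    using that x by (simp add: N.bracket_closed S_closed curvature_cochain_closed N.bracket_add_left
      N.bracket_minus_left)
  have "ad N (?B n1 n1' \<omega>1) = ad N (?B n n' \<omega>)"
    if 1: "n1 \<in> carrier N" "n1' \<in> carrier N" "\<omega>1 \<in> curvature_cochains K G N S"
      "ad N n = ad N n1" "ad N n' = ad N n1'" for n1 n1' \<omega>1
    unfolding ad_eq_iff
  proof
    fix m assume m: "m \<in> carrier N"
    have a: "N.br n u = N.br n1 u" "N.br n' u = N.br n1' u" if "u \<in> carrier N" for u
      using 1(4,5) that by (auto simp: ad_eq_iff)
    \<comment> \<open>The arguments are exchanged one at a time, the second one with the help of
      skew-symmetry.\<close>
    have "N.br n1 n1' = N.br n n'"
      using a(1)[OF 1(2)] a(2)[OF n(1)] 1(2) n N.bracket_skew[of n1' n] N.bracket_skew[of n' n] by simp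
    moreover have "N.br (S x n1') m = N.br (S x n') m" "N.br (S x' n1) m = N.br (S x' n) m"
      using a m 1 n x by (simp_all add: N.derivation_ad S_der S_closed)
    ultimately show "N.br (?B n1 n1' \<omega>1) m = N.br (?B n n' \<omega>) m"
      unfolding B[OF 1(1,2) m 1(3)] B[OF n m \<omega>]
      using bracket_curvature_cochain[OF 1(3) x m] bracket_curvature_cochain[OF \<omega> x m] by simp
  qed
  then have "(THE E. \<exists>n1\<in>carrier N. \<exists>n1'\<in>carrier N. \<exists>\<omega>1\<in>curvature_cochains K G N S.
       ad N n = ad N n1 \<and> ad N n' = ad N n1' \<and> E = ad N (?B n1 n1' \<omega>1)) = ad N (?B n n' \<omega>)"
    using n \<omega> by (intro the_equality) blast+
  then show ?thesis by (simp add: gS_bracket_def)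
qed

lemma outer_equivalent_refl: "outer_equivalent K G N S S"
  unfolding outer_equivalent_def
proof (intro exI[of _ "\<lambda>x. \<zero>\<^bsub>N\<^esub>"] conjI ballI N.continuous_linear_map_zero_map)
  fix x assume x: "x \<in> carrier G"
  show "S x = S x \<oplus>\<^bsub>der K N\<^esub> ad N \<zero>\<^bsub>N\<^esub>"
    by (rule extensionalityI[OF S_extensional[OF x]])
      (auto simp: der_add ad_apply N.bracket_zero_left S_closed x)
qed

end

lemma gS_simps:
  "carrier (gS K G N S) = ad N ` carrier N \<times> carrier G"
  "\<zero>\<^bsub>gS K G N S\<^esub> = (\<zero>\<^bsub>der K N\<^esub>, \<zero>\<^bsub>G\<^esub>)"
  "(D, x) \<oplus>\<^bsub>gS K G N S\<^esub> (D', x') = (D \<oplus>\<^bsub>der K N\<^esub> D', x \<oplus>\<^bsub>G\<^esub> x')"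
  "a \<odot>\<^bsub>gS K G N S\<^esub> (D, x) = (a \<odot>\<^bsub>der K N\<^esub> D, a \<odot>\<^bsub>G\<^esub> x)"
  "\<^bold>[s, s'\<^bold>]\<^bsub>gS K G N S\<^esub> = gS_bracket K G N S s s'"
  "vtop (gS K G N S) = prod_topology (quotient_topology (vtop N) (ad N)) (vtop G)"
  by (simp_all add: gS_def n_ad_def)

lemma lie_homD: "lie_hom K L M f \<Longrightarrow> linear_map K L M f"
  "lie_hom K L M f \<Longrightarrow> x \<in> carrier L \<Longrightarrow> y \<in> carrier L \<Longrightarrow> f \<^bold>[x, y\<^bold>]\<^bsub>L\<^esub> = \<^bold>[f x, f y\<^bold>]\<^bsub>M\<^esub>"
  by (auto simp: lie_hom_def)

section \<open>The extension of \<open>\<gg>\<^sup>S\<close> associated with an extension of \<open>\<gg>\<close>\<close>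

text \<open>Coordinates on an extension: \<open>x\<close> corresponds to the pair
  \<open>(r x, q x)\<close>, where \<open>r\<close> is the retraction complementary to \<sigma>, and
  \<sigma> realises \<open>S\<close> on the nose rather than up to equivalence.\<close>

locale adapted_extension = outer_action K G N S + H: topological_lie_algebra K H
  for K :: "'k top_ring" and G :: "('k, 'g) top_module" and N :: "('k, 'n) top_module"
    and S :: "'g \<Rightarrow> 'n \<Rightarrow> 'n" and H :: "('k, 'h) top_module" +
  fixes \<iota> :: "'n \<Rightarrow> 'h" and q :: "'h \<Rightarrow> 'g" and \<sigma> :: "'g \<Rightarrow> 'h" and r :: "'h \<Rightarrow> 'n"
  assumes extension: "is_extension K G N (H, \<iota>, q)"
    and section_linear: "continuous_linear_map K G H \<sigma>"
    and q_\<sigma>: "\<And>x. x \<in> carrier G \<Longrightarrow> q (\<sigma> x) = x"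
    and retraction_linear: "continuous_linear_map K H N r"
    and r_\<iota>: "\<And>n. n \<in> carrier N \<Longrightarrow> r (\<iota> n) = n"
    and decomposition: "\<And>x. x \<in> carrier H \<Longrightarrow> x = \<iota> (r x) \<oplus>\<^bsub>H\<^esub> \<sigma> (q x)"
    and adapted: "\<And>x. x \<in> carrier G \<Longrightarrow> ad_on N H \<iota> (\<sigma> x) = S x"
begin

lemma \<iota>_hom: "lie_hom K N H \<iota>" and q_hom: "lie_hom K H G q"
  and \<iota>_embedding: "embedding_map (vtop N) (vtop H) \<iota>"
  and \<iota>_ideal: "lie_ideal K H (\<iota> ` carrier N)"
  and q_quotient: "quotient_map (vtop H) (vtop G) q"
  and q_kernel: "{x \<in> carrier H. q x = \<zero>\<^bsub>G\<^esub>} = \<iota> ` carrier N"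
  using extension by (auto simp: is_extension_def)

lemma \<sigma>_lin: "linear_map K G H \<sigma>" and r_lin: "linear_map K H N r"
  using section_linear retraction_linear by (auto simp: continuous_linear_map_def)

lemmas \<iota>_lin = lie_homD(1)[OF \<iota>_hom] and q_lin = lie_homD(1)[OF q_hom]
lemmas \<iota>_closed = linear_map_closed[OF \<iota>_lin] and q_closed = linear_map_closed[OF q_lin]
  and \<sigma>_closed = linear_map_closed[OF \<sigma>_lin] and r_closed = linear_map_closed[OF r_lin]
lemmas \<iota>_add = linear_map_add[OF \<iota>_lin] and q_add = linear_map_add[OF q_lin]
  and r_add = linear_map_add[OF r_lin]
lemmas \<iota>_minus = linear_map_minus[OF N.is_module H.is_module \<iota>_lin]

lemma \<iota>_continuous: "continuous_map (vtop N) (vtop H) \<iota>"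
  using \<iota>_embedding homeomorphic_imp_continuous_map continuous_map_into_fulltopology
  unfolding embedding_map_def by blast

lemma \<iota>_inj: "inj_on \<iota> (carrier N)"
  using r_\<iota> by (metis inj_onI)

lemma q_\<iota>: "n \<in> carrier N \<Longrightarrow> q (\<iota> n) = \<zero>\<^bsub>G\<^esub>"
  using q_kernel by auto

lemma r_\<sigma>: "x \<in> carrier G \<Longrightarrow> r (\<sigma> x) = \<zero>\<^bsub>N\<^esub>"
proof -
  assume x: "x \<in> carrier G"
  have "\<iota> (r (\<sigma> x)) \<oplus>\<^bsub>H\<^esub> \<sigma> x = \<sigma> x"
    using decomposition[of "\<sigma> x"] x by (simp add: q_\<sigma> \<sigma>_closed)
  then have "\<iota> (r (\<sigma> x)) = \<zero>\<^bsub>H\<^esub>"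
    using x H.M.add.r_cancel_one'[of "\<sigma> x" "\<iota> (r (\<sigma> x))"] by (simp add: \<iota>_closed r_closed \<sigma>_closed)
  then have "\<iota> (r (\<sigma> x)) = \<iota> \<zero>\<^bsub>N\<^esub>"
    using linear_map_zero[OF N.is_module H.is_module \<iota>_lin] by simp
  then show ?thesis using \<iota>_inj x by (auto simp: inj_on_def r_closed \<sigma>_closed)
qed

lemma \<iota>_ad_on: "x \<in> carrier H \<Longrightarrow> n \<in> carrier N \<Longrightarrow> \<iota> (ad_on N H \<iota> x n) = H.br x (\<iota> n)"
  and ad_on_closed: "x \<in> carrier H \<Longrightarrow> n \<in> carrier N \<Longrightarrow> ad_on N H \<iota> x n \<in> carrier N"
proof -
  assume "x \<in> carrier H" "n \<in> carrier N"
  then have "H.br x (\<iota> n) \<in> \<iota> ` carrier N" using \<iota>_ideal by (auto simp: lie_ideal_def)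
  then show "\<iota> (ad_on N H \<iota> x n) = H.br x (\<iota> n)" "ad_on N H \<iota> x n \<in> carrier N"
    using \<open>n \<in> carrier N\<close> by (simp_all add: ad_on_def f_inv_into_f inv_into_into)
qed

lemma bracket_\<sigma>: "x \<in> carrier G \<Longrightarrow> n \<in> carrier N \<Longrightarrow> H.br (\<sigma> x) (\<iota> n) = \<iota> (S x n)"
  using \<iota>_ad_on[of "\<sigma> x" n] by (simp add: adapted \<sigma>_closed)

text \<open>Bracket the decomposition of \<open>x\<close> with \<open>\<iota> n\<close>: the part in
  \<open>N\<close> acts by \<open>ad (r x)\<close>, and adaptedness makes the part along \<sigma>
  act by \<open>S (q x)\<close>.\<close>

lemma ad_on_eq:
  assumes x: "x \<in> carrier H" and n: "n \<in> carrier N"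
  shows "ad_on N H \<iota> x n = N.br (r x) n \<oplus>\<^bsub>N\<^esub> S (q x) n"
proof (rule inj_onD[OF \<iota>_inj])
  have "H.br x (\<iota> n) = H.br (\<iota> (r x) \<oplus>\<^bsub>H\<^esub> \<sigma> (q x)) (\<iota> n)"
    using decomposition[OF x] by simp
  also have "\<dots> = \<iota> (N.br (r x) n \<oplus>\<^bsub>N\<^esub> S (q x) n)"
    using x n by (simp add: H.bracket_add_left \<iota>_closed r_closed q_closed \<sigma>_closed bracket_\<sigma>
        lie_homD(2)[OF \<iota>_hom] \<iota>_add N.bracket_closed S_closed)
  finally show "\<iota> (ad_on N H \<iota> x n) = \<iota> (N.br (r x) n \<oplus>\<^bsub>N\<^esub> S (q x) n)"
    by (simp add: \<iota>_ad_on x n)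
qed (use x n in \<open>auto simp: ad_on_closed N.bracket_closed S_closed r_closed q_closed\<close>)

section \<open>The map \<gamma> in the coordinates \<open>(r, q)\<close>\<close>

abbreviation \<gamma> :: "'h \<Rightarrow> ('n \<Rightarrow> 'n) \<times> 'g" where "\<gamma> \<equiv> gamma K N S (H, \<iota>, q)"

lemma gamma_eq:
  assumes x: "x \<in> carrier H"
  shows "\<gamma> x = (ad N (r x), q x)"
proof -
  have "ad_on N H \<iota> x \<ominus>\<^bsub>der K N\<^esub> S (q x) = ad N (r x)"
  proof (rule extensionalityI[of _ "carrier N"])
    fix n assume n: "n \<in> carrier N"
    have "N.br (r x) n \<oplus>\<^bsub>N\<^esub> S (q x) n \<ominus>\<^bsub>N\<^esub> S (q x) n = N.br (r x) n"
      using x n by (simp add: a_minus_def N.M.a_assoc N.M.r_neg N.bracket_closed S_closed r_closed q_closed)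
    then show "(ad_on N H \<iota> x \<ominus>\<^bsub>der K N\<^esub> S (q x)) n = ad N (r x) n"
      using x n by (simp add: N.der_minus S_der q_closed ad_on_eq ad_apply)
  qed (use x in \<open>simp_all add: N.der_minus S_der q_closed ad_extensional\<close>)
  then show ?thesis by (simp add: gamma_def)
qed

lemma gS_act_gamma:
  assumes "x \<in> carrier H" "n \<in> carrier N"
  shows "\<iota> (gS_act N S (\<gamma> x) n) = H.br x (\<iota> n)"
  using assms by (simp add: gamma_eq gS_act_def ad_apply flip: \<iota>_ad_on ad_on_eq)

lemma gamma_linear: "linear_map K H (gS K G N S) \<gamma>"
  by (auto simp: linear_map_def gamma_eq gS_simps r_closed q_closed r_add q_add N.ad_add N.ad_smult
      linear_map_smult[OF r_lin] linear_map_smult[OF q_lin])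

text \<open>Expanding both arguments along the decomposition reproduces the terms of
  \<open>gS_bracket\<close>, with the \<open>N\<close>-coordinate of
  \<open>[\<sigma> u, \<sigma> u']\<close> in the place of the cochain value. It remains to compare
  these two under \<open>ad\<close>.\<close>

lemma gamma_bracket:
  assumes x: "x \<in> carrier H" and y: "y \<in> carrier H"
  shows "\<gamma> (H.br x y) = gS_bracket K G N S (\<gamma> x) (\<gamma> y)"
proof -
  obtain \<omega> where \<omega>: "\<omega> \<in> curvature_cochains K G N S"
    using outer by (auto simp: continuous_outer_action_def)
  define n n' u u' where defs: "n = r x" "n' = r y" "u = q x" "u' = q y"
  have c: "n \<in> carrier N" "n' \<in> carrier N" "u \<in> carrier G" "u' \<in> carrier G"
    using x y by (simp_all add: defs r_closed q_closed)
  define c where "c = H.br (\<sigma> u) (\<sigma> u')"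
  have cc: "c \<in> carrier H" using c by (simp add: c_def H.bracket_closed \<sigma>_closed)
  have qc: "q c = G.br u u'" using c by (simp add: c_def lie_homD(2)[OF q_hom] \<sigma>_closed q_\<sigma>)
  \<comment> \<open>The action of \<open>c\<close> on \<open>m\<close> is computed twice: by
    \<open>ad_on_eq\<close> from its coordinates, and by the Jacobi identity as the commutator of
    \<open>S u\<close> and \<open>S u'\<close>. The comparison shows that \<open>r c\<close> acts as
    the curvature.\<close>
  have rc: "N.br (r c) m = N.br (\<omega> u u') m" if m: "m \<in> carrier N" for m
  proof -
    have "\<iota> (N.br (r c) m \<oplus>\<^bsub>N\<^esub> S (G.br u u') m) = H.br c (\<iota> m)"
      using ad_on_eq[OF cc m] \<iota>_ad_on[OF cc m] by (simp add: qc)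
    also have "\<dots> = \<iota> (S u (S u' m) \<ominus>\<^bsub>N\<^esub> S u' (S u m))"
      using c m by (simp add: c_def H.bracket_jacobi_left \<sigma>_closed \<iota>_closed bracket_\<sigma> S_closed \<iota>_minus)
    finally have "N.br (r c) m \<oplus>\<^bsub>N\<^esub> S (G.br u u') m = S u (S u' m) \<ominus>\<^bsub>N\<^esub> S u' (S u m)"
      using \<iota>_inj c m cc by (auto simp: inj_on_def N.bracket_closed S_closed G.bracket_closed r_closed)
    then show ?thesis
      using c m cc by (simp add: bracket_curvature_cochain[OF \<omega>] flip: \<open>_ = S u (S u' m) \<ominus>\<^bsub>N\<^esub> S u' (S u m)\<close>)
        (simp add: a_minus_def N.M.a_assoc N.M.r_neg N.bracket_closed S_closed G.bracket_closed r_closed)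
  qed
  have "H.br x y = H.br (\<iota> n \<oplus>\<^bsub>H\<^esub> \<sigma> u) (\<iota> n' \<oplus>\<^bsub>H\<^esub> \<sigma> u')"
    using decomposition[OF x] decomposition[OF y] by (simp add: defs)
  also have "\<dots> = (\<iota> (N.br n n') \<oplus>\<^bsub>H\<^esub> H.br (\<iota> n) (\<sigma> u')) \<oplus>\<^bsub>H\<^esub> (\<iota> (S u n') \<oplus>\<^bsub>H\<^esub> c)"
    using c by (simp add: H.bracket_add_left H.bracket_add_right \<iota>_closed \<sigma>_closed c_def bracket_\<sigma>
        lie_homD(2)[OF \<iota>_hom] H.M.a_ac H.bracket_closed S_closed)
  also have "H.br (\<iota> n) (\<sigma> u') = \<iota> (\<ominus>\<^bsub>N\<^esub> S u' n)"
    using c H.bracket_skew[of "\<sigma> u'" "\<iota> n"]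
    by (simp add: bracket_\<sigma> \<iota>_closed \<sigma>_closed S_closed linear_map_uminus[OF N.is_module H.is_module \<iota>_lin])
  finally have "r (H.br x y) = (N.br n n' \<oplus>\<^bsub>N\<^esub> \<ominus>\<^bsub>N\<^esub> S u' n) \<oplus>\<^bsub>N\<^esub> (S u n' \<oplus>\<^bsub>N\<^esub> r c)"
    using c cc by (simp add: r_add r_\<iota> \<iota>_closed N.bracket_closed S_closed)
  also have "\<dots> = N.br n n' \<oplus>\<^bsub>N\<^esub> S u n' \<ominus>\<^bsub>N\<^esub> S u' n \<oplus>\<^bsub>N\<^esub> r c"
    using c cc by (simp add: a_minus_def N.M.a_ac N.bracket_closed S_closed r_closed)
  \<comment> \<open>\<open>r c\<close> and \<open>\<omega> u u'\<close> may differ by a central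
    element; \<open>ad\<close> removes that difference.\<close>
  finally have "ad N (r (H.br x y)) = ad N (N.br n n' \<oplus>\<^bsub>N\<^esub> S u n' \<ominus>\<^bsub>N\<^esub> S u' n \<oplus>\<^bsub>N\<^esub> \<omega> u u')"
    using c cc unfolding ad_eq_iff
    by (simp add: N.bracket_add_left rc r_closed N.bracket_closed S_closed curvature_cochain_closed[OF \<omega>])
  then show ?thesis
    using x y gS_bracket_ad[OF c \<omega>]
    by (simp add: gamma_eq H.bracket_closed lie_homD(2)[OF q_hom] flip: defs)
qed

lemma gamma_continuous: "continuous_map (vtop H) (vtop (gS K G N S)) \<gamma>"
proof -
  have "continuous_map (vtop H) (quotient_topology (vtop N) (ad N)) (\<lambda>x. ad N (r x))"
    using continuous_map_compose[OF _ quotient_imp_continuous_map[OF quotient_map_quotient_topology]]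
      retraction_linear by (fastforce simp: continuous_linear_map_def o_def)
  then have "continuous_map (vtop H) (vtop (gS K G N S)) (\<lambda>x. (ad N (r x), q x))"
    by (simp add: gS_simps continuous_map_pairedI quotient_imp_continuous_map[OF q_quotient])
  then show ?thesis by (rule continuous_map_eq) (simp add: H.topspace_vtop gamma_eq)
qed

lemma gamma_kernel: "{x \<in> carrier H. \<gamma> x = \<zero>\<^bsub>gS K G N S\<^esub>} = \<iota> ` center N"
proof -
  have "x \<in> carrier H \<and> \<gamma> x = \<zero>\<^bsub>gS K G N S\<^esub> \<longleftrightarrow> x \<in> \<iota> ` center N" for x
  proof
    assume x: "x \<in> carrier H \<and> \<gamma> x = \<zero>\<^bsub>gS K G N S\<^esub>"
    then have "q x = \<zero>\<^bsub>G\<^esub>" "r x \<in> center N"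
      by (auto simp: gamma_eq gS_simps N.ad_eq_zero_iff r_closed)
    moreover from this obtain n where "n \<in> carrier N" "x = \<iota> n" using q_kernel x by auto
    ultimately show "x \<in> \<iota> ` center N" by (auto simp: r_\<iota>)
  next
    assume "x \<in> \<iota> ` center N"
    then obtain n where n: "n \<in> center N" "n \<in> carrier N" "x = \<iota> n" by (auto simp: center_def)
    then show "x \<in> carrier H \<and> \<gamma> x = \<zero>\<^bsub>gS K G N S\<^esub>"
      by (auto simp: gamma_eq gS_simps \<iota>_closed r_\<iota> q_\<iota> N.ad_eq_zero_iff)
  qed
  then show ?thesis by blast
qed

text \<open>The splitting of the centre is used twice: through \<open>s\<close> for a section of
  \<gamma>, and through \<open>P\<close> for a retraction of \<open>H\<close> onto the
  centre.\<close>

lemma is_center_extension_associated: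
  assumes split: "topologically_split K N (center N)"
  shows "is_center_extension K G N S (associated_ext K N S (H, \<iota>, q))"
proof -
  let ?g = "gS K G N S" and ?z = "center_algebra N"
  obtain s where s: "continuous_map (quotient_topology (vtop N) (ad N)) (vtop N) s"
    and ad_s: "\<And>n. n \<in> carrier N \<Longrightarrow> ad N (s (ad N n)) = ad N n"
    using N.continuous_section_ad[OF split] by blast
  have sub: "submodule (center N) K N" using split by (simp add: topologically_split_def)
  obtain P where "continuous_linear_projection K N (center N) P"
    using N.projection_of_topologically_split[OF sub split] by blast
  then have P: "linear_map K N N P" "continuous_map (vtop N) (vtop N) P"
    "\<And>x. x \<in> carrier N \<Longrightarrow> P x \<in> center N" "\<And>n. n \<in> center N \<Longrightarrow> P n = n"
    by (auto simp: continuous_linear_projection_def continuous_linear_map_def)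
  have ZN: "z \<in> carrier N" if "z \<in> center N" for z using that by (simp add: center_def)
  have sc: "s (ad N n) \<in> carrier N" if "n \<in> carrier N" for n
    using continuous_map_image_subset_topspace[OF s] that
    by (auto simp: topspace_quotient_topology N.topspace_vtop)
  \<comment> \<open>Each component is lifted separately: \<open>s\<close> picks an element of
    \<open>N\<close> inducing the inner derivation \<open>D\<close>, and \<sigma> lifts
    \<open>x\<close>.\<close>
  let ?\<tau> = "\<lambda>(D, x). \<iota> (s D) \<oplus>\<^bsub>H\<^esub> \<sigma> x"
  have \<tau>: "\<gamma> (?\<tau> m) = m" if m: "m \<in> carrier ?g" for m
  proof -
    obtain n x where nx: "n \<in> carrier N" "x \<in> carrier G" "m = (ad N n, x)"
      using m by (auto simp: gS_simps)
    then show ?thesis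
      by (simp add: gamma_eq sc \<iota>_closed \<sigma>_closed r_add r_\<iota> r_\<sigma> q_add q_\<iota> q_\<sigma> ad_s)
  qed
  have \<tau>c: "continuous_map (vtop ?g) (vtop H) ?\<tau>"
    unfolding gS_simps case_prod_unfold using section_linear
    by (intro H.continuous_map_vadd
        continuous_map_compose[OF continuous_map_compose[OF continuous_map_fst s] \<iota>_continuous, unfolded o_def]
        continuous_map_compose[OF continuous_map_snd, unfolded o_def])
      (simp add: continuous_linear_map_def)
  have surj: "\<gamma> ` carrier H = carrier ?g"
  proof
    show "\<gamma> ` carrier H \<subseteq> carrier ?g" using linear_map_closed[OF gamma_linear] by auto
    show "carrier ?g \<subseteq> \<gamma> ` carrier H"
    proof
      fix m assume m: "m \<in> carrier ?g"
      have "?\<tau> m \<in> carrier H" using m by (auto simp: gS_simps sc \<iota>_closed \<sigma>_closed)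
      then show "m \<in> \<gamma> ` carrier H" using \<tau>[OF m] by force
    qed
  qed
  \<comment> \<open>\<open>linear_map_zero\<close> would presuppose that
    \<gg>\<open>\<^sup>S\<close> is a module, which is established only afterwards by transport
    along \<gamma>; the computed kernel supplies the value at zero.\<close>
  have gzero: "\<gamma> \<zero>\<^bsub>H\<^esub> = \<zero>\<^bsub>?g\<^esub>"
  proof -
    have "\<iota> \<zero>\<^bsub>N\<^esub> = \<zero>\<^bsub>H\<^esub>" by (rule linear_map_zero[OF N.is_module H.is_module \<iota>_lin])
    moreover have "\<zero>\<^bsub>N\<^esub> \<in> center N" by (simp add: center_def N.bracket_zero_left)
    ultimately show ?thesis using gamma_kernel by force
  qed
  have g: "topological_lie_algebra K ?g"
    by (rule H.topological_lie_algebra_surj_image[OF gamma_linear surj gzero _ _ gamma_continuous \<tau>c \<tau>])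
      (auto simp: gS_simps gamma_bracket topspace_quotient_topology N.topspace_vtop G.topspace_vtop)
  have z: "topological_lie_algebra K ?z"
  proof (rule N.topological_lie_algebra_restrict_to[OF sub])
    fix x y assume "x \<in> center N" "y \<in> center N"
    then have "N.br x y = \<zero>\<^bsub>N\<^esub>" by (simp add: center_def)
    then show "N.br x y \<in> center N" by (simp add: center_def N.bracket_zero_left)
  qed
  have "is_extension K ?g ?z (H, restrict \<iota> (center N), \<gamma>)"
  proof (rule is_extensionI[OF g z H.topological_lie_algebra_axioms])
    show "lie_hom K ?z H (restrict \<iota> (center N))"
      unfolding lie_hom_def linear_map_def restrict_to_def
      using N.submoduleE[OF sub]
      by (auto simp: \<iota>_closed ZN \<iota>_add linear_map_smult[OF \<iota>_lin] lie_homD(2)[OF \<iota>_hom, symmetric])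
        (simp_all add: center_def N.bracket_zero_left)
    show "continuous_map (vtop ?z) (vtop H) (restrict \<iota> (center N))"
    proof (rule continuous_map_eq[of _ _ \<iota>])
      show "continuous_map (vtop ?z) (vtop H) \<iota>"
        by (simp add: restrict_to_def continuous_map_from_subtopology[OF \<iota>_continuous])
    qed (simp add: restrict_to_def)
    show "lie_hom K H ?g \<gamma>"
      by (simp add: lie_hom_def gamma_linear gS_simps gamma_bracket)
    show "continuous_linear_map K H ?z (\<lambda>x. P (r x))"
      using linear_map_comp[OF r_lin P(1)] continuous_map_compose[OF _ P(2), of "vtop H" r] retraction_linear
      by (auto simp: continuous_linear_map_def linear_map_def restrict_to_def P(3) r_closed o_def
          H.topspace_vtop intro!: continuous_map_into_subtopology)
    show "\<gamma> (?\<tau> m) = m" if "m \<in> carrier ?g" for m using \<tau>[OF that] .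
    show "P (r (restrict \<iota> (center N) n)) = n" if "n \<in> carrier ?z" for n
      using that by (simp add: restrict_to_def r_\<iota> ZN P(4))
    show "{x \<in> carrier H. \<gamma> x = \<zero>\<^bsub>?g\<^esub>} = restrict \<iota> (center N) ` carrier ?z"
      by (simp add: gamma_kernel restrict_to_def)
  qed (fact gamma_continuous \<tau>c)+
  moreover have "H.br x (restrict \<iota> (center N) z) = restrict \<iota> (center N) (gS_act N S (\<gamma> x) z)"
    if x: "x \<in> carrier H" and z: "z \<in> center N" for x z
  proof -
    \<comment> \<open>The inclusion of the centre is a restricted function, so it can be applied to
      the result of the action only once that result is known to be central.\<close>
    have "gS_act N S (\<gamma> x) z \<in> center N"
      using N.derivation_center[OF S_der[OF q_closed[OF x]] z] x z
      by (simp add: gamma_eq gS_act_def ad_apply r_closed q_closed S_closed ZN N.bracket_center_right)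
    then show ?thesis using x z by (simp add: gS_act_gamma ZN)
  qed
  ultimately show ?thesis by (simp add: associated_ext_def is_center_extension_def)
qed

text \<open>The preimage of \<nn>\<open>\<^sub>a\<^sub>d\<close> under \<gamma> is the kernel of
  \<open>q\<close>, that is, the image of \<iota>, and equivariance is \<open>gS_act_gamma\<close>.
  The variants \<iota>' and \<gamma>' are allowed because "comes from" asks for agreement only on
  the centre and on \<open>carrier H\<close>.\<close>

lemma equivariant_equivalence_inclusion:
  assumes \<iota>': "\<And>z. z \<in> center N \<Longrightarrow> \<iota> z = \<iota>' z" and \<gamma>': "\<And>x. x \<in> carrier H \<Longrightarrow> \<gamma>' x = \<gamma> x"
  shows "equivariant_equivalence K G N S (H, \<iota>', \<gamma>') \<iota>"
proof -
  have "{x \<in> carrier H. \<gamma>' x \<in> carrier (n_ad K N) \<times> {\<zero>\<^bsub>G\<^esub>}} = \<iota> ` carrier N"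
    using q_kernel by (auto simp: \<gamma>' gamma_eq n_ad_def r_closed \<iota>_closed q_\<iota>)
  then have pre: "preimage_n_ad K G N H \<gamma>' = restrict_to H (\<iota> ` carrier N)"
    by (simp add: preimage_n_ad_def)
  have "top_lie_iso K N (restrict_to H (\<iota> ` carrier N)) \<iota>"
    using \<iota>_hom \<iota>_embedding
    by (auto simp: top_lie_iso_def lie_hom_def linear_map_def restrict_to_def embedding_map_def N.topspace_vtop)
  then have "ext_equivalence K (center_algebra N) (N, \<lambda>z. z, ad N)
      (preimage_n_ad K G N H \<gamma>', \<iota>', \<lambda>x. fst (\<gamma>' x)) \<iota>"
    unfolding ext_equivalence_def pre
    by (auto simp: restrict_to_def \<iota>' \<gamma>' \<iota>_closed gamma_eq r_\<iota>)
  then show ?thesis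
    by (simp add: equivariant_equivalence_def \<gamma>' gS_act_gamma)
qed

end

section \<open>Extensions corresponding to the kernel, and the converse construction\<close>

context outer_action
begin

lemma adapted_extension_of_exts_kernel:
  assumes "(H, \<iota>, q) \<in> exts_kernel K G N S"
  shows "\<exists>\<sigma> r. adapted_extension K G N S H \<iota> q \<sigma> r"
proof -
  have ext: "is_extension K G N (H, \<iota>, q)" using assms by (simp add: exts_kernel_def)
  interpret H: topological_lie_algebra K H using ext by (simp add: is_extension_def)
  have q: "linear_map K H G q" and \<iota>: "lie_hom K N H \<iota>" "continuous_map (vtop N) (vtop H) \<iota>"
    and ker: "{x \<in> carrier H. q x = \<zero>\<^bsub>G\<^esub>} = \<iota> ` carrier N" and ideal: "lie_ideal K H (\<iota> ` carrier N)"
    using ext homeomorphic_imp_continuous_map continuous_map_into_fulltopology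
    by (auto simp: is_extension_def lie_hom_def embedding_map_def) blast
  obtain \<sigma>0 where \<sigma>0: "continuous_linear_map K G H \<sigma>0" "\<And>x. x \<in> carrier G \<Longrightarrow> q (\<sigma>0 x) = x"
    and cls: "kernel_class K G N (\<lambda>x. ad_on N H \<iota> (\<sigma>0 x)) = kernel_class K G N S"
    using assms by (auto simp: exts_kernel_def corresponds_to_def)
  \<comment> \<open>Equality of the classes is exploited through the member \<open>S\<close>: it
    yields the correction \<open>g\<close> that is added to \<sigma>0 below.\<close>
  have "S \<in> kernel_class K G N (\<lambda>x. ad_on N H \<iota> (\<sigma>0 x))"
    unfolding cls using outer outer_equivalent_refl by (simp add: kernel_class_def)
  then obtain g where g: "continuous_linear_map K G N g"
    and S: "\<And>x. x \<in> carrier G \<Longrightarrow> S x = ad_on N H \<iota> (\<sigma>0 x) \<oplus>\<^bsub>der K N\<^esub> ad N (g x)"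
    by (auto simp: kernel_class_def outer_equivalent_def)
  note \<iota>l = lie_homD(1)[OF \<iota>(1)]
  have \<iota>c: "continuous_linear_map K N H \<iota>" using \<iota> by (simp add: lie_hom_def continuous_linear_map_def)
  have gc: "g x \<in> carrier N" and \<sigma>0c: "\<sigma>0 x \<in> carrier H" if "x \<in> carrier G" for x
    using g \<sigma>0(1) that by (auto simp: continuous_linear_map_def linear_map_closed)
  define \<sigma> where "\<sigma> x = \<sigma>0 x \<oplus>\<^bsub>H\<^esub> \<iota> (g x)" for x
  have \<sigma>: "continuous_linear_map K G H \<sigma>"
    unfolding \<sigma>_def by (intro H.continuous_linear_map_vadd \<sigma>0 continuous_linear_map_comp[OF g \<iota>c])
  have q\<sigma>: "q (\<sigma> x) = x" if x: "x \<in> carrier G" for x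
  proof -
    have "q (\<iota> (g x)) = \<zero>\<^bsub>G\<^esub>" using ker gc[OF x] by auto
    then show ?thesis
      using x linear_map_closed[OF \<iota>l] by (simp add: \<sigma>_def linear_map_add[OF q] \<sigma>0 \<sigma>0c gc)
  qed
  obtain r where r: "continuous_linear_map K H N r" "\<And>n. n \<in> carrier N \<Longrightarrow> r (\<iota> n) = n"
    "\<And>x. x \<in> carrier H \<Longrightarrow> x = \<iota> (r x) \<oplus>\<^bsub>H\<^esub> \<sigma> (q x)"
    \<comment> \<open>The retraction is taken relative to the corrected section, so that the
      decomposition matches the one whose action is \<open>S\<close>.\<close>
    using retraction_of_section[OF ext \<sigma> q\<sigma>] by blast
  have inj: "inj_on \<iota> (carrier N)" using r(2) by (metis inj_onI)
  have "ad_on N H \<iota> (\<sigma> x) = S x" if x: "x \<in> carrier G" for x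
  proof (rule extensionalityI[of _ "carrier N"])
    fix n assume n: "n \<in> carrier N"
    have 1: "H.br (\<sigma>0 x) (\<iota> n) \<in> \<iota> ` carrier N"
      using ideal \<sigma>0c[OF x] n by (auto simp: lie_ideal_def)
    define m where "m = ad_on N H \<iota> (\<sigma>0 x) n"
    have m: "m \<in> carrier N" "\<iota> m = H.br (\<sigma>0 x) (\<iota> n)"
      using 1 n by (simp_all add: m_def ad_on_def f_inv_into_f inv_into_into)
    have "H.br (\<sigma> x) (\<iota> n) = \<iota> (m \<oplus>\<^bsub>N\<^esub> N.br (g x) n)"
      using x n m linear_map_closed[OF \<iota>l]
      by (simp add: \<sigma>_def H.bracket_add_left \<sigma>0c gc linear_map_add[OF \<iota>l] N.bracket_closed
          lie_homD(2)[OF \<iota>(1)])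
    then have "ad_on N H \<iota> (\<sigma> x) n = m \<oplus>\<^bsub>N\<^esub> N.br (g x) n"
      using n m(1) gc[OF x] by (simp add: ad_on_def inv_into_f_f[OF inj] N.bracket_closed)
    then show "ad_on N H \<iota> (\<sigma> x) n = S x n"
      using n x by (simp add: S der_add ad_apply m_def)
  qed (use x in \<open>simp_all add: S_extensional ad_on_def\<close>)
  then have "adapted_extension K G N S H \<iota> q \<sigma> r"
    by (intro adapted_extension.intro adapted_extension_axioms.intro outer_action_axioms
        H.topological_lie_algebra_axioms ext \<sigma> q\<sigma> r)
  then show ?thesis by blast
qed

lemma is_center_extension_associated_ext:
  assumes split: "topologically_split K N (center N)" and E: "E \<in> exts_kernel K G N S"
  shows "is_center_extension K G N S (associated_ext K N S E)"
proof -
  obtain H \<iota> q where [simp]: "E = (H, \<iota>, q)" by (cases E)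
  obtain \<sigma> r where "adapted_extension K G N S H \<iota> q \<sigma> r"
    using adapted_extension_of_exts_kernel[of H \<iota> q] E by auto
  then show ?thesis
    using adapted_extension.is_center_extension_associated split by simp
qed

text \<open>A kernel class evaluates its representative only on \<open>carrier G\<close>, so
  agreement there already gives equal classes.\<close>

lemma exts_kernelI:
  assumes "is_extension K G N (H, \<iota>, q)" "continuous_linear_map K G H \<sigma>"
    "\<And>x. x \<in> carrier G \<Longrightarrow> q (\<sigma> x) = x" "\<And>x. x \<in> carrier G \<Longrightarrow> ad_on N H \<iota> (\<sigma> x) = S x"
  shows "(H, \<iota>, q) \<in> exts_kernel K G N S"
proof -
  have "kernel_class K G N (\<lambda>x. ad_on N H \<iota> (\<sigma> x)) = kernel_class K G N S"
    using assms(4) by (simp add: kernel_class_def outer_equivalent_def)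
  then show ?thesis using assms by (auto simp: exts_kernel_def corresponds_to_def)
qed

text \<open>With \<alpha> as inclusion, equivariance says that \<open>ad_on\<close> at
  \<open>x\<close> is the action of \<open>\<gamma> x\<close> on \<open>N\<close>. Evaluated at
  lifts of (0, x) this gives \<open>S\<close>, and solved for the first component it gives the
  required formula for \<gamma>.\<close>

lemma comes_from_extension_of_equivariant_equivalence:
  assumes E: "is_center_extension K G N S (H, \<iota>, \<gamma>)"
    and \<alpha>: "equivariant_equivalence K G N S (H, \<iota>, \<gamma>) \<alpha>"
  shows "comes_from_extension K G N S (H, \<iota>, \<gamma>)"
proof -
  let ?g = "gS K G N S"
  have ext: "is_extension K ?g (center_algebra N) (H, \<iota>, \<gamma>)"
    using E by (simp add: is_center_extension_def)
  interpret H: topological_lie_algebra K H using ext by (simp add: is_extension_def)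
  have \<gamma>: "lie_hom K H ?g \<gamma>" "continuous_map (vtop H) (vtop ?g) \<gamma>"
    using ext quotient_imp_continuous_map by (auto simp: is_extension_def)
  note \<gamma>l = lie_homD(1)[OF \<gamma>(1)]
  have \<gamma>c: "\<gamma> x \<in> ad N ` carrier N \<times> carrier G" if "x \<in> carrier H" for x
    using linear_map_closed[OF \<gamma>l that] by (simp add: gS_simps)
  obtain \<tau> where \<tau>: "continuous_linear_map K ?g H \<tau>" "\<And>m. m \<in> carrier ?g \<Longrightarrow> \<gamma> (\<tau> m) = m"
    using is_extensionD[OF ext] by blast
  define q where "q x = snd (\<gamma> x)" for x
  define \<sigma> where "\<sigma> x = \<tau> (\<zero>\<^bsub>der K N\<^esub>, x)" for x
  define A where "A = {x \<in> carrier H. q x = \<zero>\<^bsub>G\<^esub>}"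
  have z_ad: "\<zero>\<^bsub>der K N\<^esub> \<in> ad N ` carrier N" using N.ad_zero by force
  have q: "linear_map K H G q"
    using \<gamma>c by (fastforce simp: linear_map_def q_def linear_map_add[OF \<gamma>l] linear_map_smult[OF \<gamma>l] gS_simps
        dest!: \<gamma>c split: prod.splits)
  have q_br: "q (H.br x y) = G.br (q x) (q y)" if "x \<in> carrier H" "y \<in> carrier H" for x y
    using that by (simp add: q_def lie_homD(2)[OF \<gamma>(1)] gS_simps gS_bracket_def case_prod_unfold)
  have qc: "continuous_map (vtop H) (vtop G) q"
    using continuous_map_compose[OF \<gamma>(2)[unfolded gS_simps] continuous_map_snd] by (simp add: q_def[abs_def] o_def)
  \<comment> \<open>This inclusion is in general no Lie homomorphism, since the bracket of (0, x)
    and (0, x') contains \<open>ad (\<omega> x x')\<close>. A linear section of \<open>q\<close>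
    needs no more than linearity.\<close>
  have incl: "continuous_linear_map K G ?g (\<lambda>x. (\<zero>\<^bsub>der K N\<^esub>, x))"
    unfolding continuous_linear_map_def
  proof
    have "\<zero>\<^bsub>der K N\<^esub> \<oplus>\<^bsub>der K N\<^esub> \<zero>\<^bsub>der K N\<^esub> = \<zero>\<^bsub>der K N\<^esub>"
      "a \<in> carrier K \<Longrightarrow> a \<odot>\<^bsub>der K N\<^esub> \<zero>\<^bsub>der K N\<^esub> = \<zero>\<^bsub>der K N\<^esub>" for a
      by (auto simp: der_add der_smult der_zero intro!: restrict_ext)
    then show "linear_map K G ?g (\<lambda>x. (\<zero>\<^bsub>der K N\<^esub>, x))"
      by (auto simp: linear_map_def gS_simps z_ad)
    show "continuous_map (vtop G) (vtop ?g) (\<lambda>x. (\<zero>\<^bsub>der K N\<^esub>, x))"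
      unfolding gS_simps
      by (intro continuous_map_pairedI continuous_map_id[unfolded id_def])
        (simp add: topspace_quotient_topology N.topspace_vtop z_ad)
  qed
  have \<sigma>: "continuous_linear_map K G H \<sigma>"
    unfolding \<sigma>_def by (rule continuous_linear_map_comp[OF incl \<tau>(1)])
  have \<gamma>\<sigma>: "\<gamma> (\<sigma> x) = (\<zero>\<^bsub>der K N\<^esub>, x)" if "x \<in> carrier G" for x
    using that z_ad by (simp add: \<sigma>_def \<tau>(2) gS_simps)
  have q\<sigma>: "q (\<sigma> x) = x" if "x \<in> carrier G" for x using \<gamma>\<sigma>[OF that] by (simp add: q_def)
  have \<sigma>c: "\<sigma> x \<in> carrier H" if "x \<in> carrier G" for x
    using \<sigma> that by (auto simp: continuous_linear_map_def linear_map_closed)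
  \<comment> \<open>The first component of \<open>\<gamma> x\<close> is always an inner derivation,
    so the condition on \<open>x\<close> reduces to \<open>q x\<close> = 0.\<close>
  have "{x \<in> carrier H. \<gamma> x \<in> carrier (n_ad K N) \<times> {\<zero>\<^bsub>G\<^esub>}} = A"
    using \<gamma>c by (fastforce simp: A_def q_def n_ad_def)
  then have pre: "preimage_n_ad K G N H \<gamma> = restrict_to H A" by (simp add: preimage_n_ad_def)
  have AH: "A \<subseteq> carrier H" by (auto simp: A_def)
  have iso: "top_lie_iso K N (restrict_to H A) \<alpha>" and \<alpha>\<iota>: "\<And>z. z \<in> center N \<Longrightarrow> \<alpha> z = \<iota> z"
    and act: "\<And>x n. x \<in> carrier H \<Longrightarrow> n \<in> carrier N \<Longrightarrow> \<alpha> (gS_act N S (\<gamma> x) n) = H.br x (\<alpha> n)"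
    using \<alpha> by (auto simp: equivariant_equivalence_def ext_equivalence_def pre restrict_to_def)
  have \<alpha>A: "\<alpha> n \<in> A" if "n \<in> carrier N" for n
    using iso that by (auto simp: top_lie_iso_def lie_hom_def linear_map_def restrict_to_def)
  have \<alpha>_hom: "lie_hom K N H \<alpha>"
    using iso AH by (auto simp: top_lie_iso_def lie_hom_def linear_map_def restrict_to_def)
  note \<alpha>l = lie_homD(1)[OF \<alpha>_hom]
  obtain \<beta> where "homeomorphic_maps (vtop N) (subtopology (vtop H) A) \<alpha> \<beta>"
    using iso by (auto simp: top_lie_iso_def restrict_to_def homeomorphic_map_maps)
  then have \<alpha>c: "continuous_map (vtop N) (vtop H) \<alpha>"
    and \<beta>c: "continuous_map (subtopology (vtop H) A) (vtop N) \<beta>"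
    and \<beta>\<alpha>: "\<And>n. n \<in> carrier N \<Longrightarrow> \<beta> (\<alpha> n) = n" and \<alpha>\<beta>: "\<And>x. x \<in> A \<Longrightarrow> \<alpha> (\<beta> x) = x"
    using AH by (auto simp: homeomorphic_maps_def N.topspace_vtop H.topspace_vtop
        intro: continuous_map_into_fulltopology)
  have \<beta>N: "\<beta> x \<in> carrier N" if "x \<in> A" for x
    using continuous_map_image_subset_topspace[OF \<beta>c] AH that by (auto simp: N.topspace_vtop H.topspace_vtop)
  have inj: "inj_on \<alpha> (carrier N)" using \<beta>\<alpha> by (metis inj_onI)
  \<comment> \<open>Removing the lift of \<open>q x\<close> moves \<open>x\<close> into
    \<open>A\<close>, where the inverse \<beta> of \<alpha> is defined; \<beta> after
    \<open>p\<close> is the retraction onto \<open>N\<close>.\<close>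
  define p where "p x = x \<ominus>\<^bsub>H\<^esub> \<sigma> (q x)" for x
  have p: "continuous_linear_map K H H p"
    unfolding p_def
    by (intro H.continuous_linear_map_vminus H.continuous_linear_map_id continuous_linear_map_comp[OF _ \<sigma>])
      (use q qc in \<open>simp add: continuous_linear_map_def\<close>)
  then have pl: "linear_map K H H p" and pc: "continuous_map (vtop H) (vtop H) p"
    by (auto simp: continuous_linear_map_def)
  have pA: "p x \<in> A" if x: "x \<in> carrier H" for x
  proof -
    have "q x \<in> carrier G" using linear_map_closed[OF q x] .
    then have "q (p x) = \<zero>\<^bsub>G\<^esub>" unfolding p_def using x \<sigma>c
      by (subst linear_map_minus[OF H.is_module G.is_module q])
        (auto simp: q\<sigma> a_minus_def G.M.r_neg)
    then show ?thesis using linear_map_closed[OF pl x] by (simp add: A_def)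
  qed
  \<comment> \<open>Linearity of \<beta> on \<open>A\<close> is inherited from \<alpha>: both sides
    are compared after applying the injective \<alpha>.\<close>
  have "linear_map K H N (\<lambda>x. \<beta> (p x))"
    unfolding linear_map_def
  proof (intro conjI ballI)
    show "(\<lambda>x. \<beta> (p x)) \<in> carrier H \<rightarrow> carrier N" using \<beta>N pA by auto
    show "\<beta> (p (x \<oplus>\<^bsub>H\<^esub> y)) = \<beta> (p x) \<oplus>\<^bsub>N\<^esub> \<beta> (p y)" if "x \<in> carrier H" "y \<in> carrier H" for x y
    proof (rule inj_onD[OF inj])
      show "\<alpha> (\<beta> (p (x \<oplus>\<^bsub>H\<^esub> y))) = \<alpha> (\<beta> (p x) \<oplus>\<^bsub>N\<^esub> \<beta> (p y))"
        using that pA \<beta>N \<alpha>\<beta>[OF pA[of "x \<oplus>\<^bsub>H\<^esub> y"]] by (simp add: \<alpha>\<beta> linear_map_add[OF \<alpha>l] linear_map_add[OF pl])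
    qed (use that pA \<beta>N in auto)
    show "\<beta> (p (a \<odot>\<^bsub>H\<^esub> x)) = a \<odot>\<^bsub>N\<^esub> \<beta> (p x)" if "a \<in> carrier K" "x \<in> carrier H" for a x
    proof (rule inj_onD[OF inj])
      show "\<alpha> (\<beta> (p (a \<odot>\<^bsub>H\<^esub> x))) = \<alpha> (a \<odot>\<^bsub>N\<^esub> \<beta> (p x))"
        using that pA \<beta>N \<alpha>\<beta>[OF pA[of "a \<odot>\<^bsub>H\<^esub> x"]] by (simp add: \<alpha>\<beta> linear_map_smult[OF \<alpha>l] linear_map_smult[OF pl])
    qed (use that pA \<beta>N in auto)
  qed
  moreover have "continuous_map (vtop H) (vtop N) (\<lambda>x. \<beta> (p x))"
    by (rule continuous_map_compose[OF _ \<beta>c, unfolded o_def])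
      (auto intro!: continuous_map_into_subtopology pc pA simp: H.topspace_vtop)
  ultimately have \<beta>p: "continuous_linear_map K H N (\<lambda>x. \<beta> (p x))"
    by (simp add: continuous_linear_map_def)
  have A_eq: "A = \<alpha> ` carrier N" using \<alpha>A \<alpha>\<beta> \<beta>N by force
  have ext': "is_extension K G N (H, \<alpha>, q)"
  proof (rule is_extensionI[OF G.topological_lie_algebra_axioms N.topological_lie_algebra_axioms
        H.topological_lie_algebra_axioms \<alpha>_hom \<alpha>c _ qc \<beta>p _ _ q\<sigma>])
    show "lie_hom K H G q" using q q_br by (simp add: lie_hom_def)
    show "continuous_map (vtop G) (vtop H) \<sigma>" using \<sigma> by (simp add: continuous_linear_map_def)
    show "{x \<in> carrier H. q x = \<zero>\<^bsub>G\<^esub>} = \<alpha> ` carrier N" using A_eq by (simp add: A_def)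
    show "\<beta> (p (\<alpha> n)) = n" if n: "n \<in> carrier N" for n
    proof -
      have "q (\<alpha> n) = \<zero>\<^bsub>G\<^esub>" "\<alpha> n \<in> carrier H" using \<alpha>A[OF n] by (auto simp: A_def)
      moreover have "\<sigma> \<zero>\<^bsub>G\<^esub> = \<zero>\<^bsub>H\<^esub>"
        using \<sigma> linear_map_zero[OF G.is_module H.is_module] by (auto simp: continuous_linear_map_def)
      ultimately show ?thesis using n by (simp add: p_def a_minus_def \<beta>\<alpha>)
    qed
  qed
  have gact: "gS_act N S (\<gamma> x) n = fst (\<gamma> x) n \<oplus>\<^bsub>N\<^esub> S (q x) n" for x n
    by (simp add: gS_act_def q_def case_prod_unfold)
  have fst_c: "fst (\<gamma> x) n \<in> carrier N" if "x \<in> carrier H" "n \<in> carrier N" for x n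
    using \<gamma>c[OF that(1)] that(2) by (auto simp: ad_apply N.bracket_closed)
  have ad_on_eq: "ad_on N H \<alpha> x n = fst (\<gamma> x) n \<oplus>\<^bsub>N\<^esub> S (q x) n" if "x \<in> carrier H" "n \<in> carrier N" for x n
    using that linear_map_closed[OF q] fst_c S_closed
    by (simp add: ad_on_def gact inv_into_f_f[OF inj] flip: act)
  have adapted: "ad_on N H \<alpha> (\<sigma> x) = S x" if x: "x \<in> carrier G" for x
  proof (rule extensionalityI[of _ "carrier N"])
    fix n assume n: "n \<in> carrier N"
    then show "ad_on N H \<alpha> (\<sigma> x) n = S x n"
      using x by (simp add: ad_on_eq \<sigma>c \<gamma>\<sigma> q\<sigma> der_zero S_closed)
  qed (use x in \<open>simp_all add: S_extensional ad_on_def\<close>)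
  have "(H, \<alpha>, q) \<in> exts_kernel K G N S"
    by (rule exts_kernelI[OF ext' \<sigma> q\<sigma> adapted])
  moreover have "\<gamma> x = gamma K N S (H, \<alpha>, q) x" if x: "x \<in> carrier H" for x
  proof -
    have qx: "q x \<in> carrier G" using linear_map_closed[OF q x] .
    have "fst (\<gamma> x) = ad_on N H \<alpha> x \<ominus>\<^bsub>der K N\<^esub> S (q x)"
    proof (rule extensionalityI[of _ "carrier N"])
      show "fst (\<gamma> x) \<in> extensional (carrier N)" using \<gamma>c[OF x] ad_extensional by auto
      fix n assume n: "n \<in> carrier N"
      show "fst (\<gamma> x) n = (ad_on N H \<alpha> x \<ominus>\<^bsub>der K N\<^esub> S (q x)) n"
        using n x qx fst_c[OF x n]
        by (simp add: N.der_minus S_der ad_on_eq) (simp add: a_minus_def N.M.a_assoc N.M.r_neg S_closed)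
    qed (use qx in \<open>simp add: N.der_minus S_der\<close>)
    then show ?thesis by (simp add: gamma_def q_def prod_eq_iff)
  qed
  ultimately show ?thesis using \<alpha>\<iota> unfolding comes_from_extension_def by blast
qed

end

section \<open>Equivalence of extensions\<close>

lemma top_lie_iso_inverse:
  assumes "topological_lie_algebra K L" "topological_lie_algebra K M" "top_lie_iso K L M f"
  shows "\<exists>g. top_lie_iso K M L g \<and> (\<forall>x\<in>carrier L. g (f x) = x) \<and> (\<forall>y\<in>carrier M. f (g y) = y)"
proof -
  interpret L: topological_lie_algebra K L by fact
  interpret M: topological_lie_algebra K M by fact
  have hom: "lie_hom K L M f" using assms(3) by (simp add: top_lie_iso_def)
  note f = lie_homD(1)[OF hom]
  obtain g where g: "homeomorphic_maps (vtop L) (vtop M) f g"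
    using assms(3) by (auto simp: top_lie_iso_def homeomorphic_map_maps)
  then have gf: "\<And>x. x \<in> carrier L \<Longrightarrow> g (f x) = x" and fg: "\<And>y. y \<in> carrier M \<Longrightarrow> f (g y) = y"
    and gc: "\<And>y. y \<in> carrier M \<Longrightarrow> g y \<in> carrier L"
    by (auto simp: homeomorphic_maps_def L.topspace_vtop M.topspace_vtop continuous_map_def)
  have "g (x \<oplus>\<^bsub>M\<^esub> y) = g x \<oplus>\<^bsub>L\<^esub> g y" if "x \<in> carrier M" "y \<in> carrier M" for x y
    using that gf[of "g x \<oplus>\<^bsub>L\<^esub> g y"] by (simp add: linear_map_add[OF f] gc fg)
  moreover have "g (a \<odot>\<^bsub>M\<^esub> x) = a \<odot>\<^bsub>L\<^esub> g x" if "a \<in> carrier K" "x \<in> carrier M" for a x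
    using that gf[of "a \<odot>\<^bsub>L\<^esub> g x"] by (simp add: linear_map_smult[OF f] gc fg)
  moreover have "g (M.br x y) = L.br (g x) (g y)" if "x \<in> carrier M" "y \<in> carrier M" for x y
    using that gf[of "L.br (g x) (g y)"] by (simp add: lie_homD(2)[OF hom] gc fg L.bracket_closed)
  ultimately have "lie_hom K M L g" by (auto simp: lie_hom_def linear_map_def gc)
  moreover have "homeomorphic_map (vtop M) (vtop L) g"
    using g homeomorphic_maps_sym homeomorphic_map_maps by metis
  ultimately show ?thesis using gf fg by (auto simp: top_lie_iso_def)
qed

lemma is_extension_total:
  assumes "is_extension K G N (H, \<iota>, q)"
  shows "topological_lie_algebra K H" "\<And>n. n \<in> carrier N \<Longrightarrow> \<iota> n \<in> carrier H"
  using assms by (auto simp: is_extension_def lie_hom_def linear_map_closed)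

lemma ext_equivalent_refl: "ext_equivalent K N E E"
proof -
  obtain H \<iota> q where "E = (H, \<iota>, q)" by (cases E)
  then have "ext_equivalence K N E E (\<lambda>x. x)"
    using homeomorphic_map_id[of "vtop H" "vtop H"]
    by (simp add: ext_equivalence_def top_lie_iso_def lie_hom_def linear_map_def id_def)
  then show ?thesis by (auto simp: ext_equivalent_def)
qed

lemma ext_equivalent_sym:
  assumes E1: "is_extension K G N E1" and E2: "is_extension K G N E2" and eq: "ext_equivalent K N E1 E2"
  shows "ext_equivalent K N E2 E1"
proof -
  obtain H1 \<iota>1 q1 H2 \<iota>2 q2 where [simp]: "E1 = (H1, \<iota>1, q1)" "E2 = (H2, \<iota>2, q2)" by (cases E1; cases E2)
  note e1 = is_extension_total[OF E1[simplified]] and e2 = is_extension_total[OF E2[simplified]]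
  obtain f where f: "top_lie_iso K H1 H2 f" "\<And>n. n \<in> carrier N \<Longrightarrow> f (\<iota>1 n) = \<iota>2 n"
    "\<And>x. x \<in> carrier H1 \<Longrightarrow> q2 (f x) = q1 x"
    using eq by (auto simp: ext_equivalent_def ext_equivalence_def)
  obtain g where g: "top_lie_iso K H2 H1 g" "\<And>x. x \<in> carrier H1 \<Longrightarrow> g (f x) = x"
    "\<And>y. y \<in> carrier H2 \<Longrightarrow> f (g y) = y"
    using top_lie_iso_inverse[OF e1(1) e2(1) f(1)] by blast
  have "g y \<in> carrier H1" if "y \<in> carrier H2" for y
    using g(1) that by (auto simp: top_lie_iso_def lie_hom_def linear_map_closed)
  then have "ext_equivalence K N E2 E1 g"
    using g f e1(2) by (auto simp: ext_equivalence_def simp flip: f(2) f(3))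
  then show ?thesis by (auto simp: ext_equivalent_def)
qed

lemma ext_equivalent_trans:
  assumes "ext_equivalent K N E1 E2" "ext_equivalent K N E2 E3"
  shows "ext_equivalent K N E1 E3"
proof -
  obtain H1 \<iota>1 q1 H2 \<iota>2 q2 H3 \<iota>3 q3 where
    [simp]: "E1 = (H1, \<iota>1, q1)" "E2 = (H2, \<iota>2, q2)" "E3 = (H3, \<iota>3, q3)" by (cases E1; cases E2; cases E3)
  obtain f g where f: "ext_equivalence K N E1 E2 f" and g: "ext_equivalence K N E2 E3 g"
    using assms by (auto simp: ext_equivalent_def)
  have "ext_equivalence K N E1 E3 (g \<circ> f)"
    using f g by (auto simp: ext_equivalence_def top_lie_iso_def lie_hom_def linear_map_def Pi_iff
        intro: homeomorphic_map_compose)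
  then show ?thesis by (auto simp: ext_equivalent_def)
qed

text \<open>Members of \<open>X\<close> are required to be extensions because symmetry inverts an
  isomorphism, which is done between topological Lie algebras.\<close>

lemma ext_rel_class_eq:
  assumes X: "\<And>E. E \<in> X \<Longrightarrow> is_extension K G N E"
    and "E1 \<in> X" "E2 \<in> X" "ext_equivalent K N E1 E2"
  shows "ext_rel K N X `` {E1} = ext_rel K N X `` {E2}"
  using assms(2-4) ext_equivalent_sym[OF X[OF assms(2)] X[OF assms(3)]]
  by (auto simp: ext_rel_def intro: ext_equivalent_trans)

text \<open>The same isomorphism serves. It carries \<iota>1 to \<iota>2 and preserves brackets,
  hence intertwines the two adjoint representations on \<open>N\<close>; as it also respects
  \<open>q\<close>, it respects \<gamma>.\<close>

lemma ext_equivalent_associated: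
  assumes "is_extension K G N E1" "is_extension K G N E2" "ext_equivalent K N E1 E2"
  shows "ext_equivalent K (center_algebra N) (associated_ext K N S E1) (associated_ext K N S E2)"
proof -
  obtain H1 \<iota>1 q1 H2 \<iota>2 q2 where [simp]: "E1 = (H1, \<iota>1, q1)" "E2 = (H2, \<iota>2, q2)" by (cases E1; cases E2)
  note e1 = is_extension_total[OF assms(1)[simplified]]
  have inj: "inj_on \<iota>1 (carrier N)" "inj_on \<iota>2 (carrier N)"
    using is_extensionD[OF assms(1)[simplified]] is_extensionD[OF assms(2)[simplified]] by (metis inj_onI)+
  have ideal: "\<^bold>[x, \<iota>1 n\<^bold>]\<^bsub>H1\<^esub> \<in> \<iota>1 ` carrier N" if "x \<in> carrier H1" "n \<in> carrier N" for x n
    using assms(1) that by (auto simp: is_extension_def lie_ideal_def)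
  obtain f where f: "top_lie_iso K H1 H2 f" "\<And>n. n \<in> carrier N \<Longrightarrow> f (\<iota>1 n) = \<iota>2 n"
    "\<And>x. x \<in> carrier H1 \<Longrightarrow> q2 (f x) = q1 x"
    using assms(3) by (auto simp: ext_equivalent_def ext_equivalence_def)
  have hom: "lie_hom K H1 H2 f" using f(1) by (simp add: top_lie_iso_def)
  have "ad_on N H2 \<iota>2 (f x) = ad_on N H1 \<iota>1 x" if x: "x \<in> carrier H1" for x
    unfolding ad_on_def
  proof (rule restrict_ext)
    fix n assume n: "n \<in> carrier N"
    obtain m where m: "m \<in> carrier N" "\<^bold>[x, \<iota>1 n\<^bold>]\<^bsub>H1\<^esub> = \<iota>1 m" using ideal[OF x n] by auto
    have "\<^bold>[f x, \<iota>2 n\<^bold>]\<^bsub>H2\<^esub> = \<iota>2 m"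
      using m n x e1(2) lie_homD(2)[OF hom x e1(2)[OF n]] by (simp add: f(2))
    then show "inv_into (carrier N) \<iota>2 \<^bold>[f x, \<iota>2 n\<^bold>]\<^bsub>H2\<^esub> = inv_into (carrier N) \<iota>1 \<^bold>[x, \<iota>1 n\<^bold>]\<^bsub>H1\<^esub>"
      using m inj by (simp add: inv_into_f_f)
  qed
  then have "gamma K N S E2 (f x) = gamma K N S E1 x" if "x \<in> carrier H1" for x
    using that by (simp add: gamma_def f(3))
  then have "ext_equivalence K (center_algebra N) (associated_ext K N S E1) (associated_ext K N S E2) f"
    using f by (auto simp: ext_equivalence_def associated_ext_def restrict_to_def center_def)
  then show ?thesis by (auto simp: ext_equivalent_def)
qed

theorem mainTheorem9:
  fixes K :: "'k top_ring"
    and G :: "('k, 'g) top_module"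
    and N :: "('k, 'n) top_module"
    and S :: "'g \<Rightarrow> 'n \<Rightarrow> 'n"
  assumes "topological_lie_algebra K G"
    and "topological_lie_algebra K N"
    and "continuous_outer_action K G N S"
    and "topologically_split K N (center N)"
  shows
    \<comment> \<open>the map \<open>\<gamma>\<close> defines an extension\<close>
    "(\<forall>E :: ('k, 'g, 'n, 'h) ext. E \<in> exts_kernel K G N S \<longrightarrow>
        is_center_extension K G N S (associated_ext K N S E)) \<and>
    \<comment> \<open>(1)\<close>
     (\<forall>(E1 :: ('k, 'g, 'n, 'h1) ext) (E2 :: ('k, 'g, 'n, 'h2) ext).
        E1 \<in> exts_kernel K G N S \<longrightarrow> E2 \<in> exts_kernel K G N S \<longrightarrow> ext_equivalent K N E1 E2 \<longrightarrow>
        ext_equivalent K (center_algebra N) (associated_ext K N S E1) (associated_ext K N S E2)) \<and>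
     (\<exists>\<tau> :: ('k, 'g, 'n, 'h) ext set \<Rightarrow> ('k, ('n \<Rightarrow> 'n) \<times> 'g, 'n, 'h) ext set.
        \<tau> \<in> Ext_kernel K G N S \<rightarrow> Ext_center K G N S \<and>
        (\<forall>E \<in> exts_kernel K G N S.
           \<tau> (Ext_rel K G N `` {E}) = Ext_center_rel K G N S `` {associated_ext K N S E})) \<and>
    \<comment> \<open>(2)\<close>
     (\<forall>E :: ('k, ('n \<Rightarrow> 'n) \<times> 'g, 'n, 'h) ext. is_center_extension K G N S E \<longrightarrow>
        (comes_from_extension K G N S E \<longleftrightarrow> (\<exists>\<alpha>. equivariant_equivalence K G N S E \<alpha>)))"
proof -
  interpret outer_action K G N S
    by (intro outer_action.intro outer_action_axioms.intro assms)
  \<comment> \<open>Fresh type variables for the two carriers allow this fact to be used both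
    between different types and within the single type of \<tau>.\<close>
  have one: "ext_equivalent K (center_algebra N) (associated_ext K N S E1) (associated_ext K N S E2)"
    if "E1 \<in> exts_kernel K G N S" "E2 \<in> exts_kernel K G N S" "ext_equivalent K N E1 E2"
    for E1 :: "('k, 'g, 'n, 'z1) ext" and E2 :: "('k, 'g, 'n, 'z2) ext"
    using ext_equivalent_associated[OF _ _ that(3)] that(1,2)
    unfolding exts_kernel_def by blast
  have cls: "Ext_center_rel K G N S `` {associated_ext K N S E1} = Ext_center_rel K G N S `` {associated_ext K N S E2}"
    if "E1 \<in> exts_kernel K G N S" "E2 \<in> exts_kernel K G N S" "Ext_rel K G N `` {E1} = Ext_rel K G N `` {E2}"
    for E1 E2 :: "('k, 'g, 'n, 'h) ext"
  proof -
    \<comment> \<open>\<open>E2\<close> lies in its own class, so equality of the classes makes it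
      equivalent to \<open>E1\<close>.\<close>
    have "(E2, E2) \<in> Ext_rel K G N"
      using that(2) by (simp add: Ext_rel_def ext_rel_def exts_kernel_def ext_equivalent_refl)
    then have "(E1, E2) \<in> Ext_rel K G N" using that(3) by blast
    then have "ext_equivalent K N E1 E2" by (simp add: Ext_rel_def ext_rel_def)
    then show ?thesis
      unfolding Ext_center_rel_def using is_center_extension_associated_ext[OF assms(4) that(1)] is_center_extension_associated_ext[OF assms(4) that(2)] one[OF that(1,2)]
      by (intro ext_rel_class_eq[where G = "gS K G N S"]) (auto simp: is_center_extension_def)
  qed
  \<comment> \<open>Classes are formed among all extensions of \<open>G\<close> by \<open>N\<close>,
    so the choice is confined to representatives in \<open>exts_kernel\<close>; by
    \<open>cls\<close> the value does not depend on which one is chosen.\<close>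
  define \<tau> :: "('k, 'g, 'n, 'h) ext set \<Rightarrow> ('k, ('n \<Rightarrow> 'n) \<times> 'g, 'n, 'h) ext set"
    where "\<tau> X = Ext_center_rel K G N S ``
      {associated_ext K N S (SOME E. E \<in> exts_kernel K G N S \<and> X = Ext_rel K G N `` {E})}" for X
  have \<tau>: "\<tau> (Ext_rel K G N `` {E}) = Ext_center_rel K G N S `` {associated_ext K N S E}"
    if E: "E \<in> exts_kernel K G N S" for E
  proof -
    define E' where "E' = (SOME E'. E' \<in> exts_kernel K G N S \<and> Ext_rel K G N `` {E} = Ext_rel K G N `` {E'})"
    have "E' \<in> exts_kernel K G N S \<and> Ext_rel K G N `` {E} = Ext_rel K G N `` {E'}"
      unfolding E'_def by (rule someI[of _ E]) (simp add: E)
    then have "Ext_center_rel K G N S `` {associated_ext K N S E'} = Ext_center_rel K G N S `` {associated_ext K N S E}"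
      using E by (intro cls) auto
    then show ?thesis by (simp add: \<tau>_def E'_def)
  qed
  have \<tau>_in: "\<tau> \<in> Ext_kernel K G N S \<rightarrow> Ext_center K G N S"
    using is_center_extension_associated_ext[OF assms(4)] \<tau> by (auto simp: Ext_kernel_def Ext_center_def intro!: quotientI)
  have two: "comes_from_extension K G N S E \<longleftrightarrow> (\<exists>\<alpha>. equivariant_equivalence K G N S E \<alpha>)"
    if "is_center_extension K G N S E" for E :: "('k, ('n \<Rightarrow> 'n) \<times> 'g, 'n, 'h) ext"
  proof -
    obtain H \<iota> \<gamma> where E: "E = (H, \<iota>, \<gamma>)" by (cases E)
    show ?thesis
    proof
      assume "comes_from_extension K G N S E"
      then obtain \<iota>' q where e: "(H, \<iota>', q) \<in> exts_kernel K G N S"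
        and agree: "\<And>z. z \<in> center N \<Longrightarrow> \<iota>' z = \<iota> z"
          "\<And>x. x \<in> carrier H \<Longrightarrow> \<gamma> x = gamma K N S (H, \<iota>', q) x"
        by (auto simp: comes_from_extension_def E)
      obtain \<sigma> r where "adapted_extension K G N S H \<iota>' q \<sigma> r"
        using adapted_extension_of_exts_kernel[OF e] by blast
      then show "\<exists>\<alpha>. equivariant_equivalence K G N S E \<alpha>"
        unfolding E using adapted_extension.equivariant_equivalence_inclusion agree by blast
    next
      assume "\<exists>\<alpha>. equivariant_equivalence K G N S E \<alpha>"
      then show "comes_from_extension K G N S E"
        using comes_from_extension_of_equivariant_equivalence that unfolding E by blast
    qed
  qed
  show ?thesis
    using is_center_extension_associated_ext[OF assms(4)] one \<tau> \<tau>_in two by blast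
qed

end
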